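(* Let $G$ be a six-dimensional Lie group equipped with a left-invariant Riemannian metric $g$ and containing the subgroup $K=\mathbf{SU}(2)\times\mathbf{SO}(2)$, equipped with its standard Riemannian metric, with the Lie bracket relations of the Lie algebra $\mathfrak{g}$ of $G$ written, in terms of an orthonormal basis $\{A,B,C,T,X,Y\}$ and real parameters $b_{11},b_{21},c_{11},c_{12},c_{21},c_{22},x_1,x_2,y_1,\rho,\theta_4$, in the form given in the context. Let $\mathcal{V}$ be the left-invariant distribution on $G$ generated by the Lie algebra $\mathfrak{k}=\mathfrak{su}(2)\times\mathfrak{so}(2)$. The resulting foliation $\mathcal{F}$ tangent to $\mathcal{V}$ is (1) conformal if and only if $y_1+x_2=0$ and $x_1=0$; (2) Riemannian if and only if it is conformal; (3) minimal if and only if $\rho=0$; and (4) totally geodesic if and only if $$\rho=y_1b_{11}=y_1b_{21}=y_1c_{11}=y_1c_{12}=y_1c_{21}=y_1c_{22}=0.$$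
   Context: $\{A,B,C,T,X,Y\}$ is an orthonormal basis of $\mathfrak{g}$ with respect to $g$, where $\{A,B,C\}$ spans $\mathfrak{su}(2)$, $\{T\}$ spans $\mathfrak{so}(2)$, $\mathfrak{k}=\mathrm{span}\{A,B,C,T\}$, and $\{X,Y\}$ spans the orthogonal complement $\mathfrak{m}$ of $\mathfrak{k}$. The Lie bracket relations of $\mathfrak{g}$ are ($T$ commutes with $A,B,C$): $$[A,B]=2C,\quad [C,A]=2B,\quad [B,C]=2A,$$ $$[A,X]=-b_{11}B-c_{11}C,\quad [A,Y]=-b_{21}B-c_{21}C,$$ $$[B,X]=b_{11}A-c_{12}C,\quad [B,Y]=b_{21}A-c_{22}C,$$ $$[C,X]=c_{11}A+c_{12}B,\quad [C,Y]=c_{21}A+c_{22}B,$$ $$[T,X]=x_1X+y_1Y+\tfrac12\big((-c_{12}x_1-c_{22}y_1)A+(c_{11}x_1+c_{21}y_1)B+(-b_{11}x_1-b_{21}y_1)C\big),$$ $$[T,Y]=x_2X-x_1Y+\tfrac12\big((-c_{12}x_2+c_{22}x_1)A+(c_{11}x_2-c_{21}x_1)B+(-b_{11}x_2+b_{21}x_1)C\big)-\rho T,$$ $$[X,Y]=\rho X+\theta_1A+\theta_2B+\theta_3C+\theta_4T,$$ with $\theta_1=\tfrac12(-\rho c_{12}+b_{11}c_{21}-b_{21}c_{11})$, $\theta_2=\tfrac12(\rho c_{11}+b_{11}c_{22}-b_{21}c_{12})$, $\theta_3=\tfrac12(-\rho b_{11}+c_{11}c_{22}-c_{12}c_{21})$.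 Let $\mathcal{H}$ be the orthogonal distribution of $\mathcal{V}$ (generated by $\mathfrak{m}$); $\mathcal{V},\mathcal{H}$ also denote the orthogonal projections, and $\nabla$ is the Levi-Civita connection. The second fundamental forms are $B^{\mathcal{V}}(E,F)=\tfrac12\mathcal{H}(\nabla_EF+\nabla_FE)$ for $E,F\in\mathcal{V}$ and $B^{\mathcal{H}}(Z,W)=\tfrac12\mathcal{V}(\nabla_ZW+\nabla_WZ)$ for $Z,W\in\mathcal{H}$. $\mathcal{F}$ is conformal if there is a vector field $V\in\mathcal{V}$ with $B^{\mathcal{H}}(Z,W)=g(Z,W)V$ for all $Z,W\in\mathcal{H}$; Riemannian if $B^{\mathcal{H}}=0$; minimal if $\operatorname{trace}B^{\mathcal{V}}=0$; totally geodesic if $B^{\mathcal{V}}=0$. *)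

theory Defs
  imports "HOL-Analysis.Analysis"
begin

section \<open>Smooth manifolds and Lie groups\<close>

fun Ck_on :: "nat \<Rightarrow> 'a::euclidean_space set \<Rightarrow> ('a \<Rightarrow> 'b::real_normed_vector) \<Rightarrow> bool" where
  "Ck_on 0 S f \<longleftrightarrow> continuous_on S f"
| "Ck_on (Suc k) S f \<longleftrightarrow>
     f differentiable_on S \<and> (\<forall>v. Ck_on k S (\<lambda>x. frechet_derivative f (at x) v))"

text \<open>Only used for open \<open>S\<close>. Since the domain is finite dimensional, continuity of all
  directional derivatives is continuity of the derivative.\<close>

definition smooth_on :: "'a::euclidean_space set \<Rightarrow> ('a \<Rightarrow> 'b::real_normed_vector) \<Rightarrow> bool" where
  "smooth_on S f \<longleftrightarrow> (\<forall>k. Ck_on k S f)"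

type_synonym ('g, 'e) chart = "'g set \<times> ('g \<Rightarrow> 'e)"

definition smooth_atlas :: "('g::topological_space, 'e::euclidean_space) chart set \<Rightarrow> bool" where
  "smooth_atlas \<A> \<longleftrightarrow>
     (\<forall>(U, \<phi>) \<in> \<A>. open U \<and> open (\<phi> ` U) \<and> homeomorphism U (\<phi> ` U) \<phi> (inv_into U \<phi>)) \<and>
     (\<Union>(U, \<phi>) \<in> \<A>. U) = UNIV \<and>
     (\<forall>(U, \<phi>) \<in> \<A>. \<forall>(W, \<psi>) \<in> \<A>. smooth_on (\<phi> ` (U \<inter> W)) (\<psi> \<circ> inv_into U \<phi>))"

definition smooth_map ::
  "('g::topological_space, 'e::euclidean_space) chart set \<Rightarrow>
   ('h::topological_space, 'f::euclidean_space) chart set \<Rightarrow> ('g \<Rightarrow> 'h) \<Rightarrow> bool" where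
  "smooth_map \<A> \<B> F \<longleftrightarrow> continuous_on UNIV F \<and>
     (\<forall>(U, \<phi>) \<in> \<A>. \<forall>(W, \<psi>) \<in> \<B>. smooth_on (\<phi> ` (U \<inter> F -` W)) (\<psi> \<circ> F \<circ> inv_into U \<phi>))"

definition standard_atlas :: "('e::euclidean_space, 'e) chart set" where
  "standard_atlas = {(UNIV, id)}"

definition product_atlas ::
  "('g, 'e) chart set \<Rightarrow> ('h, 'f) chart set \<Rightarrow> ('g \<times> 'h, 'e \<times> 'f) chart set" where
  "product_atlas \<A> \<B> = (\<lambda>((U, \<phi>), (W, \<psi>)). (U \<times> W, map_prod \<phi> \<psi>)) ` (\<A> \<times> \<B>)"

definition smooth_fun :: "('g::topological_space, 'e::euclidean_space) chart set \<Rightarrow> ('g \<Rightarrow> real) \<Rightarrow> bool" where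
  "smooth_fun \<A> f \<longleftrightarrow> smooth_map \<A> standard_atlas f"

definition lie_group ::
  "('g::{t2_space,second_countable_topology}, 'e::euclidean_space) chart set \<Rightarrow>
   ('g \<Rightarrow> 'g \<Rightarrow> 'g) \<Rightarrow> 'g \<Rightarrow> ('g \<Rightarrow> 'g) \<Rightarrow> bool" where
  "lie_group \<A> mul e iv \<longleftrightarrow> smooth_atlas \<A> \<and> group mul e iv \<and>
     smooth_map (product_atlas \<A> \<A>) \<A> (\<lambda>(x, y). mul x y) \<and> smooth_map \<A> \<A> iv"

section \<open>Tangent vectors and vector fields\<close>

text \<open>A tangent vector is the velocity of a smooth curve, acting on smooth functions by
  differentiation along the curve. A vector field acts on functions by \<open>(Z f)(p) = Z\<^sub>p f\<close>.
  Both are set to zero on non-smooth functions, so that equality of tangent vectors or of vector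
  fields is equality in HOL.\<close>

type_synonym 'g tvec = "('g \<Rightarrow> real) \<Rightarrow> real"
type_synonym 'g vfield = "('g \<Rightarrow> real) \<Rightarrow> 'g \<Rightarrow> real"

definition smooth_curve :: "('g::topological_space, 'e::euclidean_space) chart set \<Rightarrow> (real \<Rightarrow> 'g) \<Rightarrow> bool" where
  "smooth_curve \<A> c \<longleftrightarrow> smooth_map standard_atlas \<A> c"

definition velocity ::
  "('g::topological_space, 'e::euclidean_space) chart set \<Rightarrow> (real \<Rightarrow> 'g) \<Rightarrow> 'g tvec" where
  "velocity \<A> c = (\<lambda>f. if smooth_fun \<A> f then deriv (f \<circ> c) 0 else 0)"

definition tangent_space ::
  "('g::topological_space, 'e::euclidean_space) chart set \<Rightarrow> 'g \<Rightarrow> 'g tvec set" where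
  "tangent_space \<A> p = {velocity \<A> c | c. smooth_curve \<A> c \<and> c 0 = p}"

definition at_point :: "'g vfield \<Rightarrow> 'g \<Rightarrow> 'g tvec" where
  "at_point Z p = (\<lambda>f. Z f p)"

definition vector_field :: "('g::topological_space, 'e::euclidean_space) chart set \<Rightarrow> 'g vfield \<Rightarrow> bool" where
  "vector_field \<A> Z \<longleftrightarrow>
     (\<forall>p. at_point Z p \<in> tangent_space \<A> p) \<and> (\<forall>f. smooth_fun \<A> f \<longrightarrow> smooth_fun \<A> (Z f))"

definition vf_zero :: "'g vfield" where
  "vf_zero = (\<lambda>f p. 0)"

definition vf_add :: "'g vfield \<Rightarrow> 'g vfield \<Rightarrow> 'g vfield" where
  "vf_add Z W = (\<lambda>f p. Z f p + W f p)"

definition vf_diff :: "'g vfield \<Rightarrow> 'g vfield \<Rightarrow> 'g vfield" where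
  "vf_diff Z W = (\<lambda>f p. Z f p - W f p)"

definition vf_scale :: "('g \<Rightarrow> real) \<Rightarrow> 'g vfield \<Rightarrow> 'g vfield" where
  "vf_scale h Z = (\<lambda>f p. h p * Z f p)"

definition lie_bracket :: "'g vfield \<Rightarrow> 'g vfield \<Rightarrow> 'g vfield" where
  "lie_bracket Z W = (\<lambda>f p. Z (W f) p - W (Z f) p)"

definition lincomb :: "real list \<Rightarrow> 'g vfield list \<Rightarrow> 'g vfield" where
  "lincomb as Zs = (\<lambda>f p. \<Sum>i<length Zs. as ! i * (Zs ! i) f p)"

definition field_span :: "'g vfield list \<Rightarrow> 'g vfield set" where
  "field_span Zs = {lincomb as Zs | as. length as = length Zs}"

definition left_invariant_field ::
  "('g::topological_space, 'e::euclidean_space) chart set \<Rightarrow> ('g \<Rightarrow> 'g \<Rightarrow> 'g) \<Rightarrow> 'g vfield \<Rightarrow> bool" where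
  "left_invariant_field \<A> mul Z \<longleftrightarrow> vector_field \<A> Z \<and>
     (\<forall>a f p. smooth_fun \<A> f \<longrightarrow> Z (\<lambda>x. f (mul a x)) p = Z f (mul a p))"

definition lie_algebra ::
  "('g::topological_space, 'e::euclidean_space) chart set \<Rightarrow> ('g \<Rightarrow> 'g \<Rightarrow> 'g) \<Rightarrow> 'g vfield set" where
  "lie_algebra \<A> mul = {Z. left_invariant_field \<A> mul Z}"

section \<open>Riemannian metrics and the Levi-Civita connection\<close>

type_synonym 'g metric = "'g \<Rightarrow> 'g tvec \<Rightarrow> 'g tvec \<Rightarrow> real"

definition inner_fields :: "'g metric \<Rightarrow> 'g vfield \<Rightarrow> 'g vfield \<Rightarrow> 'g \<Rightarrow> real" where
  "inner_fields g Z W = (\<lambda>p. g p (at_point Z p) (at_point W p))"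

definition riemannian_metric ::
  "('g::topological_space, 'e::euclidean_space) chart set \<Rightarrow> 'g metric \<Rightarrow> bool" where
  "riemannian_metric \<A> g \<longleftrightarrow>
     (\<forall>p. \<forall>u \<in> tangent_space \<A> p. \<forall>v \<in> tangent_space \<A> p.
        g p u v = g p v u \<and>
        (\<forall>w \<in> tangent_space \<A> p. g p (\<lambda>f. u f + v f) w = g p u w + g p v w) \<and>
        (\<forall>a. g p (\<lambda>f. a * u f) v = a * g p u v) \<and>
        (u \<noteq> (\<lambda>f. 0) \<longrightarrow> g p u u > 0)) \<and>
     (\<forall>Z W. vector_field \<A> Z \<and> vector_field \<A> W \<longrightarrow> smooth_fun \<A> (inner_fields g Z W))"

text \<open>The differential of the left translation \<open>L\<^sub>a\<close> maps \<open>v\<close> to \<open>f \<mapsto> v (f \<circ> L\<^sub>a)\<close>.\<close>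

definition left_invariant_metric ::
  "('g::topological_space, 'e::euclidean_space) chart set \<Rightarrow> ('g \<Rightarrow> 'g \<Rightarrow> 'g) \<Rightarrow> 'g metric \<Rightarrow> bool" where
  "left_invariant_metric \<A> mul g \<longleftrightarrow> riemannian_metric \<A> g \<and>
     (\<forall>a p. \<forall>u \<in> tangent_space \<A> p. \<forall>v \<in> tangent_space \<A> p.
        g (mul a p) (\<lambda>f. u (\<lambda>x. f (mul a x))) (\<lambda>f. v (\<lambda>x. f (mul a x))) = g p u v)"

definition orthonormal_at :: "'g metric \<Rightarrow> 'g \<Rightarrow> 'g vfield list \<Rightarrow> bool" where
  "orthonormal_at g p Zs \<longleftrightarrow>
     (\<forall>i<length Zs. \<forall>j<length Zs. inner_fields g (Zs ! i) (Zs ! j) p = (if i = j then 1 else 0))"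

definition levi_civita ::
  "('g::topological_space, 'e::euclidean_space) chart set \<Rightarrow> 'g metric \<Rightarrow>
   ('g vfield \<Rightarrow> 'g vfield \<Rightarrow> 'g vfield) \<Rightarrow> bool" where
  "levi_civita \<A> g nabla \<longleftrightarrow>
     (\<forall>Z W U h. vector_field \<A> Z \<and> vector_field \<A> W \<and> vector_field \<A> U \<and> smooth_fun \<A> h \<longrightarrow>
        vector_field \<A> (nabla Z W) \<and>
        nabla (vf_add Z U) W = vf_add (nabla Z W) (nabla U W) \<and>
        nabla (vf_scale h Z) W = vf_scale h (nabla Z W) \<and>
        nabla Z (vf_add W U) = vf_add (nabla Z W) (nabla Z U) \<and>
        nabla Z (vf_scale h W) = vf_add (vf_scale (Z h) W) (vf_scale h (nabla Z W)) \<and>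
        vf_diff (nabla Z W) (nabla W Z) = lie_bracket Z W \<and>
        (\<forall>p. Z (inner_fields g W U) p =
             inner_fields g (nabla Z W) U p + inner_fields g W (nabla Z U) p))"

section \<open>Distributions and second fundamental forms\<close>

type_synonym 'g distr = "'g \<Rightarrow> 'g tvec set"

text \<open>\<open>L\<close> is meant to be a linear space of vector fields, so its values at \<open>p\<close> form a subspace.\<close>

definition generated_distr :: "'g vfield set \<Rightarrow> 'g distr" where
  "generated_distr L = (\<lambda>p. (\<lambda>Z. at_point Z p) ` L)"

definition orthogonal_distr ::
  "('g::topological_space, 'e::euclidean_space) chart set \<Rightarrow> 'g metric \<Rightarrow> 'g distr \<Rightarrow> 'g distr" where
  "orthogonal_distr \<A> g D = (\<lambda>p. {v \<in> tangent_space \<A> p. \<forall>w \<in> D p. g p v w = 0})"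

definition sections ::
  "('g::topological_space, 'e::euclidean_space) chart set \<Rightarrow> 'g distr \<Rightarrow> 'g vfield set" where
  "sections \<A> D = {Z. vector_field \<A> Z \<and> (\<forall>p. at_point Z p \<in> D p)}"

definition proj_vec :: "'g metric \<Rightarrow> 'g distr \<Rightarrow> 'g \<Rightarrow> 'g tvec \<Rightarrow> 'g tvec" where
  "proj_vec g D p v = (THE w. w \<in> D p \<and> (\<forall>u \<in> D p. g p (\<lambda>f. v f - w f) u = 0))"

definition proj_field :: "'g metric \<Rightarrow> 'g distr \<Rightarrow> 'g vfield \<Rightarrow> 'g vfield" where
  "proj_field g D Z = (\<lambda>f p. proj_vec g D p (at_point Z p) f)"

text \<open>The second fundamental form of a distribution with orthogonal complement \<open>D'\<close>.\<close>

definition second_form ::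
  "'g metric \<Rightarrow> ('g vfield \<Rightarrow> 'g vfield \<Rightarrow> 'g vfield) \<Rightarrow> 'g distr \<Rightarrow>
   'g vfield \<Rightarrow> 'g vfield \<Rightarrow> 'g vfield" where
  "second_form g nabla D' E F =
     vf_scale (\<lambda>p. 1/2) (proj_field g D' (vf_add (nabla E F) (nabla F E)))"

text \<open>In the following, \<open>V\<close> is the distribution tangent to the foliation.\<close>

definition conformal_foliation ::
  "('g::topological_space, 'e::euclidean_space) chart set \<Rightarrow> 'g metric \<Rightarrow>
   ('g vfield \<Rightarrow> 'g vfield \<Rightarrow> 'g vfield) \<Rightarrow> 'g distr \<Rightarrow> bool" where
  "conformal_foliation \<A> g nabla V \<longleftrightarrow>
     (\<exists>N \<in> sections \<A> V.
        \<forall>Z \<in> sections \<A> (orthogonal_distr \<A> g V). \<forall>W \<in> sections \<A> (orthogonal_distr \<A> g V).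
          second_form g nabla V Z W = vf_scale (inner_fields g Z W) N)"

definition riemannian_foliation ::
  "('g::topological_space, 'e::euclidean_space) chart set \<Rightarrow> 'g metric \<Rightarrow>
   ('g vfield \<Rightarrow> 'g vfield \<Rightarrow> 'g vfield) \<Rightarrow> 'g distr \<Rightarrow> bool" where
  "riemannian_foliation \<A> g nabla V \<longleftrightarrow>
     (\<forall>Z \<in> sections \<A> (orthogonal_distr \<A> g V). \<forall>W \<in> sections \<A> (orthogonal_distr \<A> g V).
        second_form g nabla V Z W = vf_zero)"

text \<open>The trace at \<open>p\<close> is computed with sections that form an orthonormal basis of \<open>V p\<close> at \<open>p\<close>;
  by tensoriality it does not depend on the choice of these sections.\<close>

definition minimal_foliation ::
  "('g::topological_space, 'e::euclidean_space) chart set \<Rightarrow> 'g metric \<Rightarrow>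
   ('g vfield \<Rightarrow> 'g vfield \<Rightarrow> 'g vfield) \<Rightarrow> 'g distr \<Rightarrow> bool" where
  "minimal_foliation \<A> g nabla V \<longleftrightarrow>
     (\<forall>p Es. set Es \<subseteq> sections \<A> V \<and> orthonormal_at g p Es \<and>
             V p = generated_distr (field_span Es) p \<longrightarrow>
        (\<forall>f. (\<Sum>E\<leftarrow>Es. second_form g nabla (orthogonal_distr \<A> g V) E E f p) = 0))"

definition totally_geodesic_foliation ::
  "('g::topological_space, 'e::euclidean_space) chart set \<Rightarrow> 'g metric \<Rightarrow>
   ('g vfield \<Rightarrow> 'g vfield \<Rightarrow> 'g vfield) \<Rightarrow> 'g distr \<Rightarrow> bool" where
  "totally_geodesic_foliation \<A> g nabla V \<longleftrightarrow>
     (\<forall>E \<in> sections \<A> V. \<forall>F \<in> sections \<A> V.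
        second_form g nabla (orthogonal_distr \<A> g V) E F = vf_zero)"

section \<open>The subgroup SU(2) x SO(2)\<close>

type_synonym mat_pair = "(complex^2^2) \<times> (real^2^2)"

definition SU2 :: "(complex^2^2) set" where
  "SU2 = {M. M ** (\<chi> i j. cnj (M $ j $ i)) = mat 1 \<and> det M = 1}"

definition SO2 :: "(real^2^2) set" where
  "SO2 = {R. orthogonal_matrix R \<and> det R = 1}"

text \<open>Smoothness of a map defined on a submanifold \<open>S\<close> of a Euclidean space:
  smooth extensions exist locally.\<close>

definition smooth_map_on_subset ::
  "'a::euclidean_space set \<Rightarrow> ('g::topological_space, 'e::euclidean_space) chart set \<Rightarrow> ('a \<Rightarrow> 'g) \<Rightarrow> bool" where
  "smooth_map_on_subset S \<A> F \<longleftrightarrow>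
     (\<forall>p \<in> S. \<forall>(U, \<phi>) \<in> \<A>. F p \<in> U \<longrightarrow>
        (\<exists>W h. open W \<and> p \<in> W \<and> smooth_on W h \<and> (\<forall>x \<in> W \<inter> S. F x \<in> U \<and> \<phi> (F x) = h x)))"

definition smooth_curve_in :: "'a::euclidean_space set \<Rightarrow> (real \<Rightarrow> 'a) \<Rightarrow> bool" where
  "smooth_curve_in S c \<longleftrightarrow> smooth_on UNIV c \<and> range c \<subseteq> S"

text \<open>\<open>\<iota>\<close> embeds \<open>SU(2) \<times> SO(2)\<close> as a Lie subgroup such that the restriction of \<open>g\<close> is the
  standard metric, i.e. the one induced by half the Euclidean inner product of matrices:
  \<open>\<langle>\<xi>, \<eta>\<rangle> = Re (tr (\<xi> \<eta>\<^sup>*)) / 2\<close> on each factor. It makes \<open>SU(2)\<close> the unit 3-sphere and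
  \<open>SO(2)\<close> the unit circle.\<close>

definition standard_subgroup ::
  "('g::topological_space, 'e::euclidean_space) chart set \<Rightarrow> ('g \<Rightarrow> 'g \<Rightarrow> 'g) \<Rightarrow> 'g metric \<Rightarrow>
   (mat_pair \<Rightarrow> 'g) \<Rightarrow> bool" where
  "standard_subgroup \<A> mul g \<iota> \<longleftrightarrow>
     inj_on \<iota> (SU2 \<times> SO2) \<and>
     (\<forall>M \<in> SU2. \<forall>R \<in> SO2. \<forall>M' \<in> SU2. \<forall>R' \<in> SO2.
        \<iota> (M ** M', R ** R') = mul (\<iota> (M, R)) (\<iota> (M', R'))) \<and>
     smooth_map_on_subset (SU2 \<times> SO2) \<A> \<iota> \<and>
     (\<forall>c d. smooth_curve_in (SU2 \<times> SO2) c \<and> smooth_curve_in (SU2 \<times> SO2) d \<and> c 0 = d 0 \<longrightarrow>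
        g (\<iota> (c 0)) (velocity \<A> (\<iota> \<circ> c)) (velocity \<A> (\<iota> \<circ> d)) =
          (vector_derivative c (at 0) \<bullet> vector_derivative d (at 0)) / 2)"

text \<open>The Lie algebra of the subgroup \<open>\<iota> ` S\<close>, as a set of left-invariant vector fields.\<close>

definition subgroup_lie_algebra ::
  "('g::topological_space, 'e::euclidean_space) chart set \<Rightarrow> ('g \<Rightarrow> 'g \<Rightarrow> 'g) \<Rightarrow> 'g \<Rightarrow>
   (mat_pair \<Rightarrow> 'g) \<Rightarrow> mat_pair set \<Rightarrow> 'g vfield set" where
  "subgroup_lie_algebra \<A> mul e \<iota> S = {Z \<in> lie_algebra \<A> mul.
     \<exists>c. smooth_curve_in S c \<and> c 0 = (mat 1, mat 1) \<and> at_point Z e = velocity \<A> (\<iota> \<circ> c)}"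

end

(*
Koszul's formula gives, for sections Z = sum z_i E_i and W = sum w_l E_l of a distribution spanned by
part of a left-invariant orthonormal frame with structure constants c_ikl, and for E_k orthogonal to it,
    g(nabla_Z W + nabla_W Z, E_k) = - sum_il z_i w_l (c_ikl + c_lki),
since the derivatives of z_i and w_l cancel. This turns all four properties into linear conditions on
the structure constants, and settles (1), (2) and (3).

For (4), assume rho = 0 and let M = (x1, y1; x2, -x1) describe ad T on m modulo k. Total geodesy says that
(b11, b21), (c11, c21), (c12, c22) lie in the kernel of M, and one has to know that M either vanishes or is
invertible with y1 nonzero. This does not follow from the Jacobi identity: the compactness of SO(2) enters.
The function u_Z(t) = (Ad(gamma(-t)) Z) f is periodic along the circle subgroup gamma generated by T, and
u_Z' = - u_[T, Z]. If x1^2 + x2 y1 >= 0, then v = u_X' satisfies v'' = (x1^2 + x2 y1) v, whence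
(v v')' >= 0 and, by periodicity, v = 0. So [T, X] = 0, likewise [T, Y] = 0, and M = 0.
*)
theory Submission
  imports Defs
begin

section \<open>Calculus of smooth functions\<close>

text \<open>Since M is trace-free, M^2 = (x1^2 + x2 y1) I. This yields the scalar equation for v and
  splits the cases by a sign: if x1^2 + x2 y1 < 0, then det M > 0 and x2 y1 < 0, so M is invertible
  and y1 is nonzero. Excluding the other sign for M \<noteq> 0 is essential: with x1 = y1 = 0 and x2
  = 1, total geodesy would force b11 = c11 = c12 = 0, while the conditions stated in (4) would leave
  these parameters free.

  Tangent vectors are velocities of curves, so tangent spaces are not linear spaces by definition.
  The linear algebra therefore runs through constant combinations of the left-invariant frame, whose
  tangency is given, and a dimension count shows that these exhaust each tangent space. Tangent
  vectors are moreover zero on non-smooth functions by convention, which causes the recurring case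
  distinction on \<open>smooth_fun\<close>.\<close>

lemma has_frechet_derivative:
  assumes "open S" "f differentiable_on S" "x \<in> S"
  shows "(f has_derivative frechet_derivative f (at x)) (at x)"
  using assms by (simp add: differentiable_on_eq_differentiable_at flip: frechet_derivative_works)

lemma frechet_derivative_eqI: "(f has_derivative f') (at x) \<Longrightarrow> frechet_derivative f (at x) v = f' v"
  by (metis frechet_derivative_at)

text \<open>On an open set the derivative at a point depends only on nearby values in the set, so
  agreement passes to derivatives of every order.\<close>

lemma Ck_on_cong:
  assumes "open S" "\<And>x. x \<in> S \<Longrightarrow> f x = h x" "Ck_on k S f"
  shows "Ck_on k S h"
  using assms(2,3)
proof (induction k arbitrary: f h)
  case 0
  then show ?case by (simp cong: continuous_on_cong)
next
  case (Suc k)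
  have d: "f differentiable_on S" using Suc by simp
  have hd: "(h has_derivative frechet_derivative f (at x)) (at x)" if "x \<in> S" for x
    by (rule has_derivative_transform_within_open[OF has_frechet_derivative[OF assms(1) d that] assms(1) that])
       (rule Suc.prems(1))
  have "Ck_on k S (\<lambda>x. frechet_derivative h (at x) v)" for v
  proof (rule Suc.IH)
    show "Ck_on k S (\<lambda>x. frechet_derivative f (at x) v)"
      using Suc.prems(2) by simp
  qed (rule frechet_derivative_eqI[OF hd, symmetric])
  moreover have "h differentiable_on S"
    by (intro differentiable_at_imp_differentiable_on differentiableI[OF hd])
  ultimately show ?case by simp
qed

text \<open>Lets the derivative be given by a formula \<open>f'\<close>; uniqueness of derivatives
  identifies it with the \<open>frechet_derivative\<close> that \<open>Ck_on\<close> refers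
  to.\<close>

lemma Ck_on_SucI:
  assumes "open S" "\<And>x. x \<in> S \<Longrightarrow> (f has_derivative f' x) (at x)" "\<And>v. Ck_on k S (\<lambda>x. f' x v)"
  shows "Ck_on (Suc k) S f"
proof -
  have "Ck_on k S (\<lambda>x. frechet_derivative f (at x) v)" for v
    by (rule Ck_on_cong[OF assms(1) _ assms(3)]) (rule frechet_derivative_eqI[OF assms(2), symmetric])
  moreover have "f differentiable_on S"
    by (intro differentiable_at_imp_differentiable_on differentiableI[OF assms(2)])
  ultimately show ?thesis by simp
qed

lemma Ck_on_subset: "Ck_on k S f \<Longrightarrow> T \<subseteq> S \<Longrightarrow> Ck_on k T f"
  by (induction k arbitrary: f) (auto intro: continuous_on_subset differentiable_on_subset)

lemma Ck_on_Suc_imp: "Ck_on (Suc k) S f \<Longrightarrow> Ck_on k S f"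
  by (induction k arbitrary: f) (auto intro: differentiable_imp_continuous_on)

text \<open>T may reach outside S. As T is open, continuity and differentiability at its points are
  unrestricted, so they carry over to the points of S whatever the shape of S.\<close>

lemma Ck_on_local:
  assumes "\<And>x. x \<in> S \<Longrightarrow> \<exists>T. open T \<and> x \<in> T \<and> Ck_on k T f"
  shows "Ck_on k S f"
  using assms
proof (induction k arbitrary: f)
  case 0
  show ?case unfolding Ck_on.simps
  proof (rule continuous_at_imp_continuous_on, rule ballI)
    fix x assume "x \<in> S"
    then obtain T where "open T" "x \<in> T" "Ck_on 0 T f" using 0 by blast
    then show "isCont f x" by (simp add: continuous_on_eq_continuous_at)
  qed
next
  case (Suc k)
  have "f differentiable (at x)" if "x \<in> S" for x
    using Suc.prems[OF that] by (auto simp: differentiable_on_eq_differentiable_at)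
  then have "f differentiable_on S" by (rule differentiable_at_imp_differentiable_on)
  moreover have "Ck_on k S (\<lambda>x. frechet_derivative f (at x) v)" for v
    by (rule Suc.IH) (use Suc.prems in \<open>metis Ck_on.simps(2)\<close>)
  ultimately show ?case by simp
qed

lemma Ck_on_const: "open S \<Longrightarrow> Ck_on k S (\<lambda>x. c)"
  by (induction k arbitrary: c) auto

lemma Ck_on_bounded_linear: "open S \<Longrightarrow> bounded_linear L \<Longrightarrow> Ck_on k S L"
proof (cases k)
  case (Suc m)
  assume "open S" "bounded_linear L"
  then show ?thesis unfolding Suc
    by (intro Ck_on_SucI[where f' = "\<lambda>x. L"] bounded_linear_imp_has_derivative Ck_on_const)
qed (simp add: linear_continuous_on)

lemma Ck_on_add:
  "open S \<Longrightarrow> Ck_on k S f \<Longrightarrow> Ck_on k S h \<Longrightarrow> Ck_on k S (\<lambda>x. f x + h x)"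
proof (induction k arbitrary: f h)
  case 0 then show ?case by (auto intro: continuous_intros)
next
  case (Suc k)
  have d: "f differentiable_on S" "h differentiable_on S" using Suc by auto
  show ?case
    by (rule Ck_on_SucI[where f' = "\<lambda>x v. frechet_derivative f (at x) v + frechet_derivative h (at x) v"])
       (use Suc.prems in \<open>auto intro!: has_derivative_add Suc.IH has_frechet_derivative[OF _ d(1)]
         has_frechet_derivative[OF _ d(2)]\<close>)
qed

lemma Ck_on_sum:
  "open S \<Longrightarrow> (\<And>i. i \<in> I \<Longrightarrow> Ck_on k S (f i)) \<Longrightarrow> Ck_on k S (\<lambda>x. \<Sum>i\<in>I. f i x)"
  by (induction I rule: infinite_finite_induct) (auto intro: Ck_on_const Ck_on_add)

lemma Ck_on_Pair:
  "open S \<Longrightarrow> Ck_on k S f \<Longrightarrow> Ck_on k S h \<Longrightarrow> Ck_on k S (\<lambda>x. (f x, h x))"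
proof (induction k arbitrary: f h)
  case 0 then show ?case by (auto intro: continuous_intros)
next
  case (Suc k)
  have d: "f differentiable_on S" "h differentiable_on S" using Suc by auto
  show ?case
    by (rule Ck_on_SucI[where f' = "\<lambda>x v. (frechet_derivative f (at x) v, frechet_derivative h (at x) v)"])
       (use Suc.prems in \<open>auto intro!: has_derivative_Pair Suc.IH has_frechet_derivative[OF _ d(1)]
         has_frechet_derivative[OF _ d(2)]\<close>)
qed

lemma (in bounded_bilinear) Ck_on:
  "open S \<Longrightarrow> Ck_on k S f \<Longrightarrow> Ck_on k S h \<Longrightarrow> Ck_on k S (\<lambda>x. prod (f x) (h x))"
proof (induction k arbitrary: f h)
  case 0 then show ?case by (auto intro: continuous_on)
next
  case (Suc k)
  have d: "f differentiable_on S" "h differentiable_on S" using Suc by auto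
  show ?case
  proof (rule Ck_on_SucI[OF Suc.prems(1), where f' = "\<lambda>x v. prod (f x) (frechet_derivative h (at x) v)
          + prod (frechet_derivative f (at x) v) (h x)"])
    fix x assume "x \<in> S"
    then show "((\<lambda>x. prod (f x) (h x)) has_derivative (\<lambda>v. prod (f x) (frechet_derivative h (at x) v)
          + prod (frechet_derivative f (at x) v) (h x))) (at x)"
      by (intro FDERIV has_frechet_derivative[OF Suc.prems(1)] d)
  next
    fix v
    have "Ck_on k S (\<lambda>x. frechet_derivative f (at x) v)" "Ck_on k S (\<lambda>x. frechet_derivative h (at x) v)"
      using Suc.prems(2,3) by auto
    then show "Ck_on k S (\<lambda>x. prod (f x) (frechet_derivative h (at x) v)
          + prod (frechet_derivative f (at x) v) (h x))"
      by (intro Ck_on_add Suc.IH Suc.prems(1) Ck_on_Suc_imp[OF Suc.prems(2)] Ck_on_Suc_imp[OF Suc.prems(3)])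
  qed
qed

lemma Ck_on_compose:
  fixes f :: "'a::euclidean_space \<Rightarrow> 'b::euclidean_space" and h :: "'b \<Rightarrow> 'c::real_normed_vector"
  assumes "open S" "open T" "f ` S \<subseteq> T"
  shows "Ck_on k S f \<Longrightarrow> Ck_on k T h \<Longrightarrow> Ck_on k S (\<lambda>x. h (f x))"
proof (induction k arbitrary: h)
  case 0
  then show ?case using assms(3) by (auto intro: continuous_on_compose2)
next
  case (Suc k)
  have d: "f differentiable_on S" "h differentiable_on T" using Suc by auto
  let ?f' = "\<lambda>x. frechet_derivative f (at x)" and ?h' = "\<lambda>y. frechet_derivative h (at y)"
  have dh: "(h has_derivative ?h' (f x)) (at (f x))" if "x \<in> S" for x
    by (rule has_frechet_derivative[OF assms(2) d(2)]) (use assms(3) that in blast)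
  show ?case
  \<comment> \<open>The chain rule applies the derivative of h to a direction that varies with x,
    whereas \<open>Ck_on\<close> speaks of fixed directions. Expansion in \<open>Basis\<close>
    reduces it to fixed directions with varying coefficients.\<close>
  proof (rule Ck_on_SucI[OF assms(1), where f' = "\<lambda>x v. \<Sum>b\<in>Basis. (?f' x v \<bullet> b) *\<^sub>R ?h' (f x) b"])
    fix x assume x: "x \<in> S"
    have lin: "linear (?h' (f x))" using dh[OF x] by (rule has_derivative_linear)
    have "?h' (f x) w = (\<Sum>b\<in>Basis. (w \<bullet> b) *\<^sub>R ?h' (f x) b)" for w
    proof -
      have "?h' (f x) (\<Sum>b\<in>Basis. (w \<bullet> b) *\<^sub>R b) = (\<Sum>b\<in>Basis. (w \<bullet> b) *\<^sub>R ?h' (f x) b)"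
        by (simp only: linear_sum[OF lin] linear_cmul[OF lin])
      then show ?thesis by (simp only: euclidean_representation)
    qed
    then have "(\<lambda>v. ?h' (f x) (?f' x v)) = (\<lambda>v. \<Sum>b\<in>Basis. (?f' x v \<bullet> b) *\<^sub>R ?h' (f x) b)"
      by (rule ext)
    then show "((\<lambda>x. h (f x)) has_derivative (\<lambda>v. \<Sum>b\<in>Basis. (?f' x v \<bullet> b) *\<^sub>R ?h' (f x) b)) (at x)"
      by (rule has_derivative_eq_rhs[OF has_derivative_compose[OF has_frechet_derivative[OF assms(1) d(1) x] dh[OF x]]])
  next
    fix v
    have fk: "Ck_on k S f" using Suc.prems(1) by (rule Ck_on_Suc_imp)
    show "Ck_on k S (\<lambda>x. \<Sum>b\<in>Basis. (?f' x v \<bullet> b) *\<^sub>R ?h' (f x) b)"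
    proof (intro Ck_on_sum bounded_bilinear.Ck_on[OF bounded_bilinear_scaleR] assms(1))
      fix b :: 'b
      show "Ck_on k S (\<lambda>x. ?f' x v \<bullet> b)"
        using Suc.prems(1) by (intro bounded_bilinear.Ck_on[OF bounded_bilinear_inner] Ck_on_const assms(1)) auto
      show "Ck_on k S (\<lambda>x. ?h' (f x) b)"
        by (rule Suc.IH[of "\<lambda>y. ?h' y b", OF fk]) (use Suc.prems(2) in simp)
    qed
  qed
qed

lemma smooth_on_compose:
  fixes f :: "'a::euclidean_space \<Rightarrow> 'b::euclidean_space" and h :: "'b \<Rightarrow> 'c::real_normed_vector"
  assumes "open S" "open T" "f ` S \<subseteq> T" "smooth_on S f" "smooth_on T h"
  shows "smooth_on S (\<lambda>x. h (f x))"
  using assms Ck_on_compose unfolding smooth_on_def by blast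

lemma smooth_on_cong:
  "open S \<Longrightarrow> (\<And>x. x \<in> S \<Longrightarrow> f x = h x) \<Longrightarrow> smooth_on S f \<Longrightarrow> smooth_on S h"
  unfolding smooth_on_def using Ck_on_cong by blast

lemma smooth_on_subset: "smooth_on S f \<Longrightarrow> T \<subseteq> S \<Longrightarrow> smooth_on T f"
  unfolding smooth_on_def using Ck_on_subset by blast

lemma smooth_on_local:
  assumes "\<And>x. x \<in> S \<Longrightarrow> \<exists>T. open T \<and> x \<in> T \<and> smooth_on T f"
  shows "smooth_on S f"
  unfolding smooth_on_def
proof (intro allI Ck_on_local)
  fix k x assume "x \<in> S"
  then show "\<exists>T. open T \<and> x \<in> T \<and> Ck_on k T f"
    using assms unfolding smooth_on_def by blast
qed

lemma smooth_on_Pair: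
  "open S \<Longrightarrow> smooth_on S f \<Longrightarrow> smooth_on S h \<Longrightarrow> smooth_on S (\<lambda>x. (f x, h x))"
  unfolding smooth_on_def using Ck_on_Pair by blast

lemma smooth_on_const: "open S \<Longrightarrow> smooth_on S (\<lambda>x. c)"
  unfolding smooth_on_def using Ck_on_const by blast

lemma smooth_on_bounded_linear: "open S \<Longrightarrow> bounded_linear L \<Longrightarrow> smooth_on S L"
  unfolding smooth_on_def using Ck_on_bounded_linear by blast

lemma smooth_on_imp_continuous_on: "smooth_on S f \<Longrightarrow> continuous_on S f"
  unfolding smooth_on_def using Ck_on.simps(1) by blast

lemma smooth_on_imp_has_derivative:
  "smooth_on S f \<Longrightarrow> open S \<Longrightarrow> x \<in> S \<Longrightarrow> (f has_derivative frechet_derivative f (at x)) (at x)"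
  unfolding smooth_on_def using Ck_on.simps(2) has_frechet_derivative by blast

lemma smooth_on_frechet_derivative:
  "smooth_on S f \<Longrightarrow> smooth_on S (\<lambda>x. frechet_derivative f (at x) v)"
  unfolding smooth_on_def using Ck_on.simps(2) by blast

text \<open>The constants are arbitrary to make the family closed under differentiation: P and Q are
  replaced by multiples of Q and P, and N by 0. The instance of interest is a rotation curve of
  matrices.\<close>

lemma smooth_on_cos_sin:
  fixes P Q N :: "'a::real_normed_vector"
  shows "smooth_on UNIV (\<lambda>t::real. cos (r * t) *\<^sub>R P + sin (r * t) *\<^sub>R Q + N)"
proof -
  have "Ck_on k UNIV (\<lambda>t::real. cos (r * t) *\<^sub>R P + sin (r * t) *\<^sub>R Q + N)" for k
  proof (induction k arbitrary: P Q N)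
    case 0
    show ?case by (auto intro!: continuous_intros)
  next
    case (Suc k)
    show ?case
    proof (rule Ck_on_SucI[OF open_UNIV])
      fix t
      show "((\<lambda>t. cos (r * t) *\<^sub>R P + sin (r * t) *\<^sub>R Q + N) has_derivative
         (\<lambda>v. cos (r * t) *\<^sub>R ((r * v) *\<^sub>R Q) + sin (r * t) *\<^sub>R (- (r * v) *\<^sub>R P) + 0)) (at t)"
        by (rule derivative_eq_intros refl)+ (auto simp: algebra_simps)
    qed (rule Suc)
  qed
  then show ?thesis unfolding smooth_on_def by blast
qed

text \<open>Both mixed derivatives are the limit of one second difference divided by h^2, and this
  difference is symmetric in u and v. Two applications of the mean value theorem and continuity of
  the mixed derivative give the limit.\<close>

lemma second_derivative_symmetric:
  fixes K :: "'a::euclidean_space \<Rightarrow> real"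
  assumes "smooth_on UNIV K"
  shows "frechet_derivative (\<lambda>y. frechet_derivative K (at y) u) (at x) v
       = frechet_derivative (\<lambda>y. frechet_derivative K (at y) v) (at x) u"
proof -
  define D where "D u = (\<lambda>y. frechet_derivative K (at y) u)" for u
  define DD where "DD u v = (\<lambda>y. frechet_derivative (D u) (at y) v)" for u v
  have hK: "(K has_derivative (\<lambda>u. D u y)) (at y)" for y
    using smooth_on_imp_has_derivative[OF assms] by (simp add: D_def)
  have sD: "smooth_on UNIV (D u)" for u
    unfolding D_def by (rule smooth_on_frechet_derivative[OF assms])
  have hD: "(D u has_derivative (\<lambda>v. DD u v y)) (at y)" for u y
    using smooth_on_imp_has_derivative[OF sD] by (simp add: DD_def)
  have cDD: "isCont (DD u v) y" for u v y
    using smooth_on_imp_continuous_on[OF smooth_on_frechet_derivative[OF sD]]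
    by (simp add: DD_def continuous_on_eq_continuous_at)
  have scale: "DD u (c *\<^sub>R v) y = c * DD u v y" for u v c y
    using linear_cmul[OF has_derivative_linear[OF hD]] by simp
  have scaleD: "D (c *\<^sub>R u) y = c * D u y" for u c y
    using linear_cmul[OF has_derivative_linear[OF hK]] by simp
  have mvt: "\<exists>s r. 0 < s \<and> s < h \<and> 0 < r \<and> r < h \<and>
        K (x + h *\<^sub>R u + h *\<^sub>R v) - K (x + h *\<^sub>R u) - K (x + h *\<^sub>R v) + K x
          = h\<^sup>2 * DD u v (x + s *\<^sub>R u + r *\<^sub>R v)" if h: "0 < h" for h u v
  proof -
    have 1: "DERIV (\<lambda>s. K (x + s *\<^sub>R u + h *\<^sub>R v) - K (x + s *\<^sub>R u)) s
           :> D u (x + s *\<^sub>R u + h *\<^sub>R v) - D u (x + s *\<^sub>R u)" for s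
    proof -
      have "((\<lambda>s. K (x + s *\<^sub>R u + h *\<^sub>R v)) has_derivative (\<lambda>c. D (c *\<^sub>R u) (x + s *\<^sub>R u + h *\<^sub>R v))) (at s)"
        by (rule has_derivative_compose[OF _ hK, of "\<lambda>s. x + s *\<^sub>R u + h *\<^sub>R v" "\<lambda>c. c *\<^sub>R u"])
           (auto intro!: derivative_eq_intros)
      moreover have "((\<lambda>s. K (x + s *\<^sub>R u)) has_derivative (\<lambda>c. D (c *\<^sub>R u) (x + s *\<^sub>R u))) (at s)"
        by (rule has_derivative_compose[OF _ hK, of "\<lambda>s. x + s *\<^sub>R u" "\<lambda>c. c *\<^sub>R u"])
           (auto intro!: derivative_eq_intros)
      ultimately show ?thesis
        unfolding has_field_derivative_def
        by (rule has_derivative_eq_rhs[OF has_derivative_diff]) (simp add: scaleD fun_eq_iff algebra_simps)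
    qed
    obtain s where s: "0 < s" "s < h"
      "(K (x + h *\<^sub>R u + h *\<^sub>R v) - K (x + h *\<^sub>R u)) - (K (x + h *\<^sub>R v) - K x)
         = h * (D u (x + s *\<^sub>R u + h *\<^sub>R v) - D u (x + s *\<^sub>R u))"
      using MVT2[OF h 1] by auto
    have 2: "DERIV (\<lambda>r. D u (x + s *\<^sub>R u + r *\<^sub>R v)) r :> DD u v (x + s *\<^sub>R u + r *\<^sub>R v)" for r
      unfolding has_field_derivative_def
      by (rule has_derivative_eq_rhs[OF has_derivative_compose[OF _ hD, of "\<lambda>r. x + s *\<^sub>R u + r *\<^sub>R v" "\<lambda>c. c *\<^sub>R v"]])
         (auto intro!: derivative_eq_intros simp: scale)
    obtain r where r: "0 < r" "r < h"
      "D u (x + s *\<^sub>R u + h *\<^sub>R v) - D u (x + s *\<^sub>R u) = h * DD u v (x + s *\<^sub>R u + r *\<^sub>R v)"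
      using MVT2[OF h 2] by auto
    have "K (x + h *\<^sub>R u + h *\<^sub>R v) - K (x + h *\<^sub>R u) - K (x + h *\<^sub>R v) + K x
        = h * (D u (x + s *\<^sub>R u + h *\<^sub>R v) - D u (x + s *\<^sub>R u))"
      by (subst s(3)[symmetric]) simp
    also have "\<dots> = h\<^sup>2 * DD u v (x + s *\<^sub>R u + r *\<^sub>R v)"
      unfolding r(3) by (simp add: power2_eq_square)
    finally show ?thesis
      using s(1,2) r(1,2) by blast
  qed
  have lim: "((\<lambda>h. (K (x + h *\<^sub>R u + h *\<^sub>R v) - K (x + h *\<^sub>R u) - K (x + h *\<^sub>R v) + K x) / h\<^sup>2)
      \<longlongrightarrow> DD u v x) (at_right 0)" for u v
  proof -
    define P where "P h s r \<longleftrightarrow> 0 < s \<and> s < h \<and> 0 < r \<and> r < h \<and>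
        K (x + h *\<^sub>R u + h *\<^sub>R v) - K (x + h *\<^sub>R u) - K (x + h *\<^sub>R v) + K x
          = h\<^sup>2 * DD u v (x + s *\<^sub>R u + r *\<^sub>R v)" for h s r
    \<comment> \<open>The intermediate points are chosen as functions of h, to be squeezed between 0
      and h.\<close>
    have "\<forall>h. \<exists>s r. 0 < h \<longrightarrow> P h s r"
      using mvt[of _ u v, folded P_def] by blast
    then obtain s r where P: "\<And>h. 0 < h \<Longrightarrow> P h (s h) (r h)"
      unfolding choice_iff by blast
    note sr = P[unfolded P_def]
    have ev: "eventually (\<lambda>h::real. 0 < h) (at_right 0)" by (simp add: eventually_at_right_less)
    have s0: "(s \<longlongrightarrow> 0) (at_right 0)"
      by (rule tendsto_sandwich[of "\<lambda>h. 0" _ _ "\<lambda>h. h"])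
         (use sr in \<open>auto intro!: eventually_mono[OF ev] less_imp_le\<close>)
    have r0: "(r \<longlongrightarrow> 0) (at_right 0)"
      by (rule tendsto_sandwich[of "\<lambda>h. 0" _ _ "\<lambda>h. h"])
         (use sr in \<open>auto intro!: eventually_mono[OF ev] less_imp_le\<close>)
    have "((\<lambda>h. x + s h *\<^sub>R u + r h *\<^sub>R v) \<longlongrightarrow> x + 0 *\<^sub>R u + 0 *\<^sub>R v) (at_right 0)"
      by (intro tendsto_intros s0 r0)
    then have "((\<lambda>h. DD u v (x + s h *\<^sub>R u + r h *\<^sub>R v)) \<longlongrightarrow> DD u v x) (at_right 0)"
      by (intro isCont_tendsto_compose[OF cDD]) simp
    then show ?thesis
      by (rule Lim_transform_eventually) (rule eventually_mono[OF ev], use sr in force)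
  qed
  have "DD u v x = DD v u x"
    by (rule tendsto_unique[OF _ lim[of u v]])
       (use lim[of v u] in \<open>simp_all add: algebra_simps trivial_limit_at_right_real\<close>)
  then show ?thesis by (simp add: DD_def D_def)
qed

section \<open>Smooth maps between manifolds\<close>

text \<open>The topological part of \<open>smooth_atlas\<close>. Smooth maps are tested in all pairs
  of charts, so composition and pairing rest on this part, and it passes to products without
  differentiating transition maps.\<close>

definition chart_atlas :: "('g::topological_space, 'e::euclidean_space) chart set \<Rightarrow> bool" where
  "chart_atlas \<A> \<longleftrightarrow>
     (\<forall>(U, \<phi>) \<in> \<A>. open U \<and> open (\<phi> ` U) \<and> homeomorphism U (\<phi> ` U) \<phi> (inv_into U \<phi>)) \<and>
     (\<Union>(U, \<phi>) \<in> \<A>. U) = UNIV"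

lemma smooth_atlas_imp_chart_atlas: "smooth_atlas \<A> \<Longrightarrow> chart_atlas \<A>"
  unfolding smooth_atlas_def chart_atlas_def by blast

lemma chart_around:
  assumes "chart_atlas \<A>"
  obtains U \<phi> where "(U, \<phi>) \<in> \<A>" "p \<in> U"
proof -
  have "p \<in> (\<Union>(U, \<phi>) \<in> \<A>. U)" using assms unfolding chart_atlas_def by simp
  then show ?thesis using that by blast
qed

lemma
  assumes "chart_atlas \<A>" "(U, \<phi>) \<in> \<A>"
  shows chart_open: "open U"
    and chart_open_image: "open V \<Longrightarrow> V \<subseteq> U \<Longrightarrow> open (\<phi> ` V)"
    and chart_inj: "inj_on \<phi> U"
    and chart_inverse: "x \<in> U \<Longrightarrow> inv_into U \<phi> (\<phi> x) = x"
    and chart_continuous: "continuous_on U \<phi>"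
    and chart_inverse_continuous: "continuous_on (\<phi> ` U) (inv_into U \<phi>)"
proof -
  have h: "open U" "open (\<phi> ` U)" "homeomorphism U (\<phi> ` U) \<phi> (inv_into U \<phi>)"
    using assms unfolding chart_atlas_def by auto
  show "open U" by (rule h)
  show i: "x \<in> U \<Longrightarrow> inv_into U \<phi> (\<phi> x) = x" for x
    using h(3) unfolding homeomorphism_def by blast
  then show "inj_on \<phi> U" by (metis inj_onI)
  show "continuous_on U \<phi>" "continuous_on (\<phi> ` U) (inv_into U \<phi>)"
    using h(3) unfolding homeomorphism_def by auto
  assume V: "open V" "V \<subseteq> U"
  have "openin (top_of_set (\<phi> ` U)) (\<phi> ` V)"
    by (rule homeomorphism_imp_open_map[OF h(3)]) (use V h(1) in \<open>simp add: openin_open_eq\<close>)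
  then show "open (\<phi> ` V)" using h(2) by (simp add: openin_open_eq)
qed

lemma chart_atlas_standard: "chart_atlas standard_atlas"
  by (simp add: chart_atlas_def standard_atlas_def homeomorphism_def image_id)

lemma chart_atlas_product:
  assumes A: "chart_atlas \<A>" and B: "chart_atlas \<B>"
  shows "chart_atlas (product_atlas \<A> \<B>)"
  unfolding chart_atlas_def
proof (intro conjI ballI, clarify)
  fix Q \<kappa> assume "(Q, \<kappa>) \<in> product_atlas \<A> \<B>"
  then obtain U \<phi> W \<psi> where c: "(U, \<phi>) \<in> \<A>" "(W, \<psi>) \<in> \<B>" and Q: "Q = U \<times> W" "\<kappa> = map_prod \<phi> \<psi>"
    unfolding product_atlas_def by auto
  have im: "\<kappa> ` Q = \<phi> ` U \<times> \<psi> ` W" unfolding Q by (rule map_prod_surj_on[OF refl refl])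
  have inj: "inj_on \<kappa> Q"
    unfolding Q by (rule map_prod_inj_on[OF chart_inj[OF A c(1)] chart_inj[OF B c(2)]])
  have inv: "inv_into Q \<kappa> y = (inv_into U \<phi> (fst y), inv_into W \<psi> (snd y))" if "y \<in> \<phi> ` U \<times> \<psi> ` W" for y
  proof (rule inv_into_f_eq[OF inj])
    show "(inv_into U \<phi> (fst y), inv_into W \<psi> (snd y)) \<in> Q"
      using that by (auto simp: Q inv_into_into)
    show "\<kappa> (inv_into U \<phi> (fst y), inv_into W \<psi> (snd y)) = y"
      using that by (auto simp: Q f_inv_into_f)
  qed
  have cont: "continuous_on Q \<kappa>"
    unfolding Q map_prod_def split_beta'
    by (intro continuous_on_Pair continuous_on_compose2[OF chart_continuous[OF A c(1)]]
        continuous_on_compose2[OF chart_continuous[OF B c(2)]] continuous_on_fst continuous_on_snd continuous_on_id) auto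
  have "continuous_on (\<phi> ` U \<times> \<psi> ` W) (\<lambda>y. (inv_into U \<phi> (fst y), inv_into W \<psi> (snd y)))"
    by (intro continuous_on_Pair continuous_on_compose2[OF chart_inverse_continuous[OF A c(1)]]
        continuous_on_compose2[OF chart_inverse_continuous[OF B c(2)]] continuous_on_fst continuous_on_snd continuous_on_id) auto
  then have "continuous_on (\<kappa> ` Q) (inv_into Q \<kappa>)"
    unfolding im by (rule continuous_on_eq) (simp add: inv)
  with cont inj have "homeomorphism Q (\<kappa> ` Q) \<kappa> (inv_into Q \<kappa>)"
    by (simp add: homeomorphism_def inv_into_image_cancel f_inv_into_f)
  moreover have "open Q" unfolding Q by (rule open_Times[OF chart_open[OF A c(1)] chart_open[OF B c(2)]])
  moreover have "open (\<kappa> ` Q)"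
    unfolding im
    by (rule open_Times[OF chart_open_image[OF A c(1) chart_open[OF A c(1)] order_refl]
          chart_open_image[OF B c(2) chart_open[OF B c(2)] order_refl]])
  ultimately show "open Q \<and> open (\<kappa> ` Q) \<and> homeomorphism Q (\<kappa> ` Q) \<kappa> (inv_into Q \<kappa>)" by blast
next
  have "(p, q) \<in> (\<Union>(U, \<phi>) \<in> product_atlas \<A> \<B>. U)" for p q
  proof -
    obtain U \<phi> where U: "(U, \<phi>) \<in> \<A>" "p \<in> U" by (rule chart_around[OF A])
    obtain W \<psi> where W: "(W, \<psi>) \<in> \<B>" "q \<in> W" by (rule chart_around[OF B])
    have "(U \<times> W, map_prod \<phi> \<psi>) \<in> product_atlas \<A> \<B>"
      unfolding product_atlas_def by (rule image_eqI[of _ _ "((U, \<phi>), (W, \<psi>))"]) (use U W in auto)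
    then show ?thesis using U W by blast
  qed
  then show "(\<Union>(U, \<phi>) \<in> product_atlas \<A> \<B>. U) = UNIV" by auto
qed

lemma smooth_map_imp_continuous: "smooth_map \<A> \<B> F \<Longrightarrow> continuous_on UNIV F"
  unfolding smooth_map_def by blast

lemma smooth_map_charts:
  "smooth_map \<A> \<B> F \<Longrightarrow> (U, \<phi>) \<in> \<A> \<Longrightarrow> (W, \<psi>) \<in> \<B> \<Longrightarrow>
    smooth_on (\<phi> ` (U \<inter> F -` W)) (\<psi> \<circ> F \<circ> inv_into U \<phi>)"
  unfolding smooth_map_def by blast

lemma smooth_mapI:
  assumes "continuous_on UNIV F"
    and "\<And>U \<phi> W \<psi>. (U, \<phi>) \<in> \<A> \<Longrightarrow> (W, \<psi>) \<in> \<B> \<Longrightarrow>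
      smooth_on (\<phi> ` (U \<inter> F -` W)) (\<psi> \<circ> F \<circ> inv_into U \<phi>)"
  shows "smooth_map \<A> \<B> F"
  using assms unfolding smooth_map_def by blast

text \<open>Near each point a chart of the middle manifold is inserted, and the two coordinate
  expressions are composed.\<close>

lemma smooth_map_compose:
  assumes A: "chart_atlas \<A>" and B: "chart_atlas \<B>" and C: "chart_atlas \<C>"
    and F: "smooth_map \<A> \<B> F" and G: "smooth_map \<B> \<C> G"
  shows "smooth_map \<A> \<C> (\<lambda>x. G (F x))"
proof (rule smooth_mapI)
  note cF = smooth_map_imp_continuous[OF F] and cG = smooth_map_imp_continuous[OF G]
  show cGF: "continuous_on UNIV (\<lambda>x. G (F x))"
    by (rule continuous_on_compose2[OF cG cF subset_UNIV])
  fix U \<phi> W \<kappa> assume U: "(U, \<phi>) \<in> \<A>" and W: "(W, \<kappa>) \<in> \<C>"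
  show "smooth_on (\<phi> ` (U \<inter> (\<lambda>x. G (F x)) -` W)) (\<kappa> \<circ> (\<lambda>x. G (F x)) \<circ> inv_into U \<phi>)"
  proof (rule smooth_on_local)
    fix y assume "y \<in> \<phi> ` (U \<inter> (\<lambda>x. G (F x)) -` W)"
    then obtain x where x: "x \<in> U" "G (F x) \<in> W" "y = \<phi> x" by blast
    obtain V \<psi> where V: "(V, \<psi>) \<in> \<B>" "F x \<in> V" by (rule chart_around[OF B])
    let ?S = "U \<inter> F -` V \<inter> (\<lambda>x. G (F x)) -` W"
    have oS: "open (\<phi> ` ?S)"
      by (intro chart_open_image[OF A U] open_Int open_vimage chart_open[OF A U] chart_open[OF B V(1)]
          chart_open[OF C W] cF cGF) blast
    have oT: "open (\<psi> ` (V \<inter> G -` W))"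
      by (intro chart_open_image[OF B V(1)] open_Int open_vimage chart_open[OF B V(1)] chart_open[OF C W] cG) blast
    have inv: "inv_into U \<phi> (\<phi> z) = z" if "z \<in> U" for z
      using chart_inverse[OF A U that] .
    have "smooth_on (\<phi> ` ?S) (\<lambda>y. (\<kappa> \<circ> G \<circ> inv_into V \<psi>) ((\<psi> \<circ> F \<circ> inv_into U \<phi>) y))"
    proof (rule smooth_on_compose[OF oS oT])
      show "(\<psi> \<circ> F \<circ> inv_into U \<phi>) ` \<phi> ` ?S \<subseteq> \<psi> ` (V \<inter> G -` W)"
        using inv by auto
      show "smooth_on (\<phi> ` ?S) (\<psi> \<circ> F \<circ> inv_into U \<phi>)"
        by (rule smooth_on_subset[OF smooth_map_charts[OF F U V(1)]]) blast
    qed (rule smooth_map_charts[OF G V(1) W])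
    then have "smooth_on (\<phi> ` ?S) (\<kappa> \<circ> (\<lambda>x. G (F x)) \<circ> inv_into U \<phi>)"
      by (rule smooth_on_cong[OF oS, rotated]) (use inv chart_inverse[OF B V(1)] in auto)
    then show "\<exists>T. open T \<and> y \<in> T \<and> smooth_on T (\<kappa> \<circ> (\<lambda>x. G (F x)) \<circ> inv_into U \<phi>)"
      using oS x V(2) by blast
  qed
qed

lemma smooth_map_Pair:
  assumes N: "chart_atlas \<N>" and A: "chart_atlas \<A>" and B: "chart_atlas \<B>"
    and F: "smooth_map \<N> \<A> F" and G: "smooth_map \<N> \<B> G"
  shows "smooth_map \<N> (product_atlas \<A> \<B>) (\<lambda>x. (F x, G x))"
proof (rule smooth_mapI)
  note cF = smooth_map_imp_continuous[OF F] and cG = smooth_map_imp_continuous[OF G]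
  show "continuous_on UNIV (\<lambda>x. (F x, G x))" by (intro continuous_on_Pair cF cG)
  fix U \<phi> Q \<kappa> assume U: "(U, \<phi>) \<in> \<N>" and "(Q, \<kappa>) \<in> product_atlas \<A> \<B>"
  then obtain V \<alpha> W \<beta> where c: "(V, \<alpha>) \<in> \<A>" "(W, \<beta>) \<in> \<B>" and Q: "Q = V \<times> W" "\<kappa> = map_prod \<alpha> \<beta>"
    unfolding product_atlas_def by auto
  let ?S = "U \<inter> F -` V \<inter> G -` W"
  have oS: "open (\<phi> ` ?S)"
    by (intro chart_open_image[OF N U] open_Int open_vimage chart_open[OF N U] chart_open[OF A c(1)]
        chart_open[OF B c(2)] cF cG) blast
  have "smooth_on (\<phi> ` ?S) (\<alpha> \<circ> F \<circ> inv_into U \<phi>)"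
    by (rule smooth_on_subset[OF smooth_map_charts[OF F U c(1)]]) blast
  moreover have "smooth_on (\<phi> ` ?S) (\<beta> \<circ> G \<circ> inv_into U \<phi>)"
    by (rule smooth_on_subset[OF smooth_map_charts[OF G U c(2)]]) blast
  ultimately have "smooth_on (\<phi> ` ?S) (\<lambda>y. ((\<alpha> \<circ> F \<circ> inv_into U \<phi>) y, (\<beta> \<circ> G \<circ> inv_into U \<phi>) y))"
    by (rule smooth_on_Pair[OF oS])
  moreover have "U \<inter> (\<lambda>x. (F x, G x)) -` Q = ?S" unfolding Q by auto
  moreover have "\<kappa> \<circ> (\<lambda>x. (F x, G x)) \<circ> inv_into U \<phi>
      = (\<lambda>y. ((\<alpha> \<circ> F \<circ> inv_into U \<phi>) y, (\<beta> \<circ> G \<circ> inv_into U \<phi>) y))"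
    unfolding Q by auto
  ultimately show "smooth_on (\<phi> ` (U \<inter> (\<lambda>x. (F x, G x)) -` Q)) (\<kappa> \<circ> (\<lambda>x. (F x, G x)) \<circ> inv_into U \<phi>)"
    by simp
qed

lemma smooth_map_const:
  assumes "chart_atlas \<N>"
  shows "smooth_map \<N> \<A> (\<lambda>x. a)"
proof (rule smooth_mapI)
  fix U \<phi> W \<psi> assume U: "(U, \<phi>) \<in> \<N>"
  have "open (\<phi> ` (U \<inter> (\<lambda>x. a) -` W))"
    by (rule chart_open_image[OF assms U])
       (use chart_open[OF assms U] in \<open>auto simp: vimage_const\<close>)
  then show "smooth_on (\<phi> ` (U \<inter> (\<lambda>x. a) -` W)) (\<psi> \<circ> (\<lambda>x. a) \<circ> inv_into U \<phi>)"
    unfolding comp_def by (rule smooth_on_const)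
qed simp

text \<open>In charts the identity is a transition map; the compatibility of charts enters
  here.\<close>

lemma smooth_map_ident: "smooth_atlas \<A> \<Longrightarrow> smooth_map \<A> \<A> (\<lambda>x. x)"
  by (rule smooth_mapI) (force simp: smooth_atlas_def comp_def)+

lemma smooth_map_standard_iff: "smooth_map standard_atlas standard_atlas f \<longleftrightarrow> smooth_on UNIV f"
  by (auto simp: smooth_map_def standard_atlas_def intro: smooth_on_imp_continuous_on)

lemma smooth_map_bounded_linear: "bounded_linear L \<Longrightarrow> smooth_map standard_atlas standard_atlas L"
  by (simp add: smooth_map_standard_iff smooth_on_bounded_linear)

lemma smooth_fun_compose:
  assumes "chart_atlas \<A>" "chart_atlas \<B>" "smooth_map \<A> \<B> F" "smooth_fun \<B> f"
  shows "smooth_fun \<A> (\<lambda>x. f (F x))"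
  using smooth_map_compose[OF assms(1,2) chart_atlas_standard assms(3)] assms(4)
  by (simp add: smooth_fun_def)

lemma smooth_fun_along_curve:
  assumes "chart_atlas \<A>" "smooth_fun \<A> f" "smooth_curve \<A> c"
  shows "smooth_on UNIV (\<lambda>t. f (c t))"
  using smooth_fun_compose[OF chart_atlas_standard assms(1) _ assms(2)] assms(3)
  by (simp add: smooth_curve_def smooth_fun_def smooth_map_standard_iff)

section \<open>Tangent vectors as velocities of curves\<close>

lemma velocity_nonsmooth: "\<not> smooth_fun \<A> f \<Longrightarrow> velocity \<A> c f = 0"
  by (simp add: velocity_def)

lemma has_derivative_along_curve:
  assumes "chart_atlas \<A>" "smooth_fun \<A> f" "smooth_curve \<A> c"
  shows "((\<lambda>t. f (c t)) has_real_derivative velocity \<A> c f) (at 0)"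
proof -
  have "(\<lambda>t. f (c t)) differentiable (at 0)"
    using smooth_on_imp_has_derivative[OF smooth_fun_along_curve[OF assms], of 0] by (auto intro: differentiableI)
  then show ?thesis
    using assms(2) by (simp add: velocity_def comp_def DERIV_deriv_iff_real_differentiable)
qed

lemma tangent_space_nonsmooth: "v \<in> tangent_space \<A> p \<Longrightarrow> \<not> smooth_fun \<A> f \<Longrightarrow> v f = 0"
  unfolding tangent_space_def by (auto simp: velocity_nonsmooth)

lemma tangent_spaceE:
  assumes "v \<in> tangent_space \<A> p" "chart_atlas \<A>"
  obtains c where "smooth_curve \<A> c" "c 0 = p" "v = velocity \<A> c"
    "\<And>f. smooth_fun \<A> f \<Longrightarrow> ((\<lambda>t. f (c t)) has_real_derivative v f) (at 0)"
  using assms has_derivative_along_curve unfolding tangent_space_def by blast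

text \<open>The vector w is the derivative of \<phi> \<circ> c at 0. A single w serves all f, which
  bounds the dimension of the tangent space by \<open>DIM('e)\<close>.\<close>

lemma velocity_in_chart:
  assumes A: "chart_atlas \<A>" and U: "(U, \<phi>) \<in> \<A>" and c: "smooth_curve \<A> c" "c 0 \<in> U"
  obtains w where "\<And>f. smooth_fun \<A> f \<Longrightarrow>
    velocity \<A> c f = frechet_derivative (f \<circ> inv_into U \<phi>) (at (\<phi> (c 0))) w"
proof -
  have cc: "continuous_on UNIV c"
    using c(1) unfolding smooth_curve_def by (rule smooth_map_imp_continuous)
  have oV: "open (c -` U)" by (rule open_vimage[OF chart_open[OF A U] cc])
  have "smooth_on (c -` U) (\<lambda>t. \<phi> (c t))"
    using smooth_map_charts[OF c(1)[unfolded smooth_curve_def] _ U, of UNIV id]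
    by (simp add: standard_atlas_def comp_def)
  then have d: "((\<lambda>t. \<phi> (c t)) has_derivative frechet_derivative (\<lambda>t. \<phi> (c t)) (at 0)) (at 0)"
    by (rule smooth_on_imp_has_derivative[OF _ oV]) (use c(2) in simp)
  show ?thesis
  proof (rule that)
    fix f assume f: "smooth_fun \<A> f"
    let ?fh = "f \<circ> inv_into U \<phi>"
    have "smooth_on (\<phi> ` U) ?fh"
      using smooth_map_charts[OF f[unfolded smooth_fun_def] U, of UNIV id]
      by (simp add: standard_atlas_def)
    then have df: "(?fh has_derivative frechet_derivative ?fh (at (\<phi> (c 0)))) (at (\<phi> (c 0)))"
      by (rule smooth_on_imp_has_derivative[OF _ chart_open_image[OF A U chart_open[OF A U] order_refl]])
         (use c(2) in blast)
    have "((\<lambda>t. ?fh (\<phi> (c t))) has_derivative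
        (\<lambda>s. frechet_derivative ?fh (at (\<phi> (c 0))) (frechet_derivative (\<lambda>t. \<phi> (c t)) (at 0) s))) (at 0)"
      by (rule has_derivative_compose[OF d df])
    then have "((\<lambda>t. f (c t)) has_derivative
        (\<lambda>s. frechet_derivative ?fh (at (\<phi> (c 0))) (frechet_derivative (\<lambda>t. \<phi> (c t)) (at 0) s))) (at 0)"
      by (rule has_derivative_transform_within_open[OF _ oV]) (use c(2) chart_inverse[OF A U] in auto)
    from has_derivative_unique[OF this has_derivative_along_curve[OF A f c(1), unfolded has_field_derivative_def]]
    show "velocity \<A> c f
        = frechet_derivative ?fh (at (\<phi> (c 0))) (frechet_derivative (\<lambda>t. \<phi> (c t)) (at 0) 1)"
      by (metis mult_1_right)
  qed
qed

text \<open>\<open>smooth_map_on_subset\<close> provides extensions h in charts and does not speak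
  of continuity of F. Along a curve that stays in S, \<phi> \<circ> F \<circ> c and h \<circ> c
  agree locally, and continuity is recovered by applying the inverse chart to h \<circ> c.\<close>

lemma smooth_curve_on_subset:
  assumes A: "chart_atlas \<A>" and F: "smooth_map_on_subset S \<A> F" and c: "smooth_curve_in S c"
  shows "smooth_curve \<A> (F \<circ> c)"
proof -
  have sc: "smooth_on UNIV c" and cS: "\<And>t. c t \<in> S"
    using c unfolding smooth_curve_in_def by auto
  have cc: "continuous_on UNIV c" by (rule smooth_on_imp_continuous_on[OF sc])
  have loc: "\<exists>T h. open T \<and> t \<in> T \<and> smooth_on T h \<and> (\<forall>s\<in>T. F (c s) \<in> U \<and> \<phi> (F (c s)) = h s)"
    if U: "(U, \<phi>) \<in> \<A>" "F (c t) \<in> U" for U \<phi> t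
  proof -
    have "F (c t) \<in> U \<longrightarrow> (\<exists>W h. open W \<and> c t \<in> W \<and> smooth_on W h \<and> (\<forall>x\<in>W \<inter> S. F x \<in> U \<and> \<phi> (F x) = h x))"
      using bspec[OF bspec[OF F[unfolded smooth_map_on_subset_def] cS] U(1)] by (simp only: prod.case)
    then obtain W h where W: "open W" "c t \<in> W" "smooth_on W h" "\<And>x. x \<in> W \<Longrightarrow> x \<in> S \<Longrightarrow> F x \<in> U \<and> \<phi> (F x) = h x"
      using U(2) by (elim impE exE conjE) auto
    have o: "open (c -` W)" by (rule open_vimage[OF W(1) cc])
    have "smooth_on (c -` W) (\<lambda>s. h (c s))"
      by (rule smooth_on_compose[OF o W(1) _ smooth_on_subset[OF sc] W(3)]) auto
    moreover have "\<forall>s\<in>c -` W. F (c s) \<in> U \<and> \<phi> (F (c s)) = h (c s)" using W(4)[OF _ cS] by simp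
    moreover have "t \<in> c -` W" using W(2) by simp
    ultimately show ?thesis using o by (intro exI conjI)
  qed
  show ?thesis
    unfolding smooth_curve_def
  proof (rule smooth_mapI)
    have "isCont (F \<circ> c) t" for t
    proof -
      obtain U \<phi> where U: "(U, \<phi>) \<in> \<A>" "F (c t) \<in> U" by (rule chart_around[OF A])
      obtain T h where T: "open T" "t \<in> T" "smooth_on T h" "\<forall>s\<in>T. F (c s) \<in> U \<and> \<phi> (F (c s)) = h s"
        using loc[OF U] by (elim exE conjE)
      have "continuous_on T (\<lambda>s. inv_into U \<phi> (h s))"
        by (rule continuous_on_compose2[OF chart_inverse_continuous[OF A U(1)] smooth_on_imp_continuous_on[OF T(3)]])
           (use T(4) in \<open>force simp: image_iff\<close>)
      moreover have "inv_into U \<phi> (h s) = (F \<circ> c) s" if "s \<in> T" for s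
        using chart_inverse[OF A U(1), of "F (c s)"] T(4) that by (simp add: comp_def)
      ultimately have "continuous_on T (F \<circ> c)"
        by (rule continuous_on_eq)
      then show ?thesis using T(1,2) continuous_on_eq_continuous_at by blast
    qed
    then show "continuous_on UNIV (F \<circ> c)" by (intro continuous_at_imp_continuous_on ballI)
  next
    fix V \<psi> U \<phi> assume "(V, \<psi>) \<in> (standard_atlas :: (real, real) chart set)" and U: "(U, \<phi>) \<in> \<A>"
    then have V: "V = UNIV" "\<psi> = id" by (auto simp: standard_atlas_def)
    have "smooth_on ((F \<circ> c) -` U) (\<phi> \<circ> (F \<circ> c))"
    proof (rule smooth_on_local)
      fix t assume "t \<in> (F \<circ> c) -` U"
      then have "F (c t) \<in> U" by simp
      then obtain T h where T: "open T" "t \<in> T" "smooth_on T h" "\<forall>s\<in>T. F (c s) \<in> U \<and> \<phi> (F (c s)) = h s"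
        using loc[OF U, of t] by (elim meta_impE exE conjE)
      have "smooth_on T (\<phi> \<circ> (F \<circ> c))"
        by (rule smooth_on_cong[OF T(1) _ T(3)]) (use T(4) in simp)
      then show "\<exists>T. open T \<and> t \<in> T \<and> smooth_on T (\<phi> \<circ> (F \<circ> c))" using T(1,2) by (intro exI conjI)
    qed
    then show "smooth_on (\<psi> ` (V \<inter> (F \<circ> c) -` U)) (\<phi> \<circ> (F \<circ> c) \<circ> inv_into V \<psi>)"
      by (simp add: V)
  qed
qed

section \<open>Left-invariant orthonormal frames\<close>

lemma has_real_derivative_sum_mult:
  assumes "\<And>i. i \<in> I \<Longrightarrow> (h i has_real_derivative h' i) (at t)" "\<And>i. i \<in> I \<Longrightarrow> (k i has_real_derivative k' i) (at t)"
  shows "((\<lambda>t. \<Sum>i\<in>I. h i t * k i t) has_real_derivative (\<Sum>i\<in>I. h' i * k i t + h i t * k' i)) (at t)"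
proof (rule DERIV_sum)
  fix i assume "i \<in> I"
  from DERIV_mult[OF assms(1)[OF this] assms(2)[OF this]]
  show "((\<lambda>t. h i t * k i t) has_real_derivative h' i * k i t + h i t * k' i) (at t)"
    by (rule DERIV_cong) simp
qed

text \<open>The Leibniz rule for a sum of products, with F as a function of its own: it is applied
  to Z f and to g(Z, W), whose smoothness is known beforehand. The empty sum shows that v kills the
  zero function.\<close>

lemma tangent_derivation:
  assumes A: "chart_atlas \<A>" and v: "v \<in> tangent_space \<A> p" and F: "smooth_fun \<A> F"
    and h: "\<And>i. i \<in> I \<Longrightarrow> smooth_fun \<A> (h i)" and k: "\<And>i. i \<in> I \<Longrightarrow> smooth_fun \<A> (k i)"
    and eq: "\<And>x. F x = (\<Sum>i\<in>I. h i x * k i x)"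
  shows "v F = (\<Sum>i\<in>I. v (h i) * k i p + h i p * v (k i))"
proof -
  obtain c where c: "c 0 = p" and d: "\<And>f. smooth_fun \<A> f \<Longrightarrow> ((\<lambda>t. f (c t)) has_real_derivative v f) (at 0)"
    using tangent_spaceE[OF v A] by metis
  have "((\<lambda>t. \<Sum>i\<in>I. h i (c t) * k i (c t)) has_real_derivative
      (\<Sum>i\<in>I. v (h i) * k i (c 0) + h i (c 0) * v (k i))) (at 0)"
    by (rule has_real_derivative_sum_mult[OF d[OF h] d[OF k]])
  then show ?thesis
    using DERIV_unique[OF d[OF F]] unfolding eq c by simp
qed

text \<open>\<open>left_invariant_comb\<close> says more than left invariance of each
  \<open>fr i\<close>: that a sum of velocities is again a velocity has to be supplied from outside.
  Orthonormality is asked at e only, since left invariance of the metric spreads it.\<close>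

locale lie_group_frame =
  fixes \<A> :: "('g::{t2_space,second_countable_topology}, 'e::euclidean_space) chart set"
    and mul :: "'g \<Rightarrow> 'g \<Rightarrow> 'g" and e :: 'g and iv :: "'g \<Rightarrow> 'g" and g :: "'g metric"
    and fr :: "nat \<Rightarrow> 'g vfield" and n :: nat
  assumes lie_group: "lie_group \<A> mul e iv"
    and metric: "left_invariant_metric \<A> mul g"
    and dim: "DIM('e) = n"
    and left_invariant_comb: "left_invariant_field \<A> mul (\<lambda>f p. \<Sum>i<n. a i * fr i f p)"
    and orthonormal_e: "i < n \<Longrightarrow> j < n \<Longrightarrow> inner_fields g (fr i) (fr j) e = (if i = j then 1 else 0)"
begin

lemma smooth_atlas: "smooth_atlas \<A>"
  and chart_atlas: "chart_atlas \<A>"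
  and group: "group mul e iv"
  and smooth_mul: "smooth_map (product_atlas \<A> \<A>) \<A> (\<lambda>(x, y). mul x y)"
  using lie_group smooth_atlas_imp_chart_atlas unfolding lie_group_def by auto

lemma mul_assoc: "mul (mul a b) c = mul a (mul b c)"
  and mul_e_left: "mul e a = a"
  and mul_iv_left: "mul (iv a) a = e"
  and mul_iv_right: "mul a (iv a) = e"
  using group by (simp_all add: group.left_inverse group.group_left_neutral group.axioms semigroup.assoc
      group.right_inverse)

lemma mul_e_right: "mul a e = a"
  using mul_assoc[of a "iv a" a] by (simp add: mul_e_left mul_iv_left mul_iv_right)

lemma smooth_map_mul:
  assumes "chart_atlas \<N>" "smooth_map \<N> \<A> F" "smooth_map \<N> \<A> G"
  shows "smooth_map \<N> \<A> (\<lambda>x. mul (F x) (G x))"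
  using smooth_map_compose[OF assms(1) chart_atlas_product[OF chart_atlas chart_atlas] chart_atlas
      smooth_map_Pair[OF assms(1) chart_atlas chart_atlas assms(2,3)] smooth_mul]
  by simp

lemma smooth_left_translation: "smooth_map \<A> \<A> (\<lambda>x. mul a x)"
  by (rule smooth_map_mul[OF chart_atlas smooth_map_const[OF chart_atlas] smooth_map_ident[OF smooth_atlas]])

lemma smooth_right_translation: "smooth_map \<A> \<A> (\<lambda>x. mul x a)"
  by (rule smooth_map_mul[OF chart_atlas smooth_map_ident[OF smooth_atlas] smooth_map_const[OF chart_atlas]])

lemma smooth_fun_left_translate: "smooth_fun \<A> f \<Longrightarrow> smooth_fun \<A> (\<lambda>x. f (mul a x))"
  by (rule smooth_fun_compose[OF chart_atlas chart_atlas smooth_left_translation])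

lemma smooth_fun_right_translate: "smooth_fun \<A> f \<Longrightarrow> smooth_fun \<A> (\<lambda>x. f (mul x a))"
  by (rule smooth_fun_compose[OF chart_atlas chart_atlas smooth_right_translation])

text \<open>Tangent vectors are zero on non-smooth functions, so comparing one with its left
  translate requires that translation preserves non-smoothness too.\<close>

lemma smooth_fun_left_translate_iff: "smooth_fun \<A> (\<lambda>x. f (mul a x)) \<longleftrightarrow> smooth_fun \<A> f"
proof
  assume "smooth_fun \<A> (\<lambda>x. f (mul a x))"
  then have "smooth_fun \<A> (\<lambda>x. f (mul a (mul (iv a) x)))"
    by (rule smooth_fun_left_translate)
  moreover have "mul a (mul (iv a) x) = x" for x
    by (simp add: mul_e_left mul_iv_right flip: mul_assoc)
  ultimately show "smooth_fun \<A> f" by simp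
qed (rule smooth_fun_left_translate)

definition comb :: "(nat \<Rightarrow> real) \<Rightarrow> 'g \<Rightarrow> 'g tvec" where
  "comb a p = (\<lambda>f. \<Sum>i<n. a i * fr i f p)"

lemma comb_tangent: "comb a p \<in> tangent_space \<A> p"
  using left_invariant_comb[of a] unfolding left_invariant_field_def vector_field_def at_point_def comb_def
  by blast

lemma comb_single:
  assumes "j < n"
  shows "comb (\<lambda>i. if i = j then c else 0) p = (\<lambda>f. c * fr j f p)"
proof
  fix f
  have "comb (\<lambda>i. if i = j then c else 0) p f = (\<Sum>i<n. if i = j then c * fr i f p else 0)"
    unfolding comb_def by (rule sum.cong) auto
  then show "comb (\<lambda>i. if i = j then c else 0) p f = c * fr j f p"
    using assms by simp
qed

lemma frame_eq_comb: "j < n \<Longrightarrow> at_point (fr j) p = comb (\<lambda>i. if i = j then 1 else 0) p"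
  by (simp add: comb_single at_point_def)

lemma frame_left_invariant:
  assumes "j < n"
  shows "left_invariant_field \<A> mul (fr j)"
proof -
  have "(\<lambda>f p. \<Sum>i<n. (if i = j then 1 else 0) * fr i f p) = fr j"
    using comb_single[OF assms, of 1, unfolded comb_def] by (simp add: fun_eq_iff)
  then show ?thesis using left_invariant_comb[of "\<lambda>i. if i = j then 1 else 0"] by simp
qed

lemma frame_vector_field: "j < n \<Longrightarrow> vector_field \<A> (fr j)"
  using frame_left_invariant unfolding left_invariant_field_def by blast

lemma frame_tangent: "j < n \<Longrightarrow> at_point (fr j) p \<in> tangent_space \<A> p"
  by (simp add: frame_eq_comb comb_tangent)

lemma frame_smooth: "j < n \<Longrightarrow> smooth_fun \<A> f \<Longrightarrow> smooth_fun \<A> (fr j f)"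
  using frame_vector_field unfolding vector_field_def by blast

lemma
  assumes "u \<in> tangent_space \<A> p" "v \<in> tangent_space \<A> p"
  shows g_sym: "g p u v = g p v u"
    and g_add: "w \<in> tangent_space \<A> p \<Longrightarrow> g p (\<lambda>f. u f + v f) w = g p u w + g p v w"
    and g_scale: "g p (\<lambda>f. a * u f) v = a * g p u v"
  using metric assms unfolding left_invariant_metric_def riemannian_metric_def by blast+

lemma translate_frame:
  assumes "j < n"
  shows "(\<lambda>f. at_point (fr j) e (\<lambda>x. f (mul p x))) = at_point (fr j) p"
proof
  fix f
  show "at_point (fr j) e (\<lambda>x. f (mul p x)) = at_point (fr j) p f"
  proof (cases "smooth_fun \<A> f")
    case True
    then show ?thesis
      using frame_left_invariant[OF assms] unfolding left_invariant_field_def at_point_def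
      by (simp add: mul_e_right)
  next
    case False
    then show ?thesis
      using tangent_space_nonsmooth[OF frame_tangent[OF assms]] smooth_fun_left_translate_iff by simp
  qed
qed

lemma frame_orthonormal:
  assumes "i < n" "j < n"
  shows "g p (at_point (fr i) p) (at_point (fr j) p) = (if i = j then 1 else 0)"
proof -
  have "g (mul p e) (\<lambda>f. at_point (fr i) e (\<lambda>x. f (mul p x))) (\<lambda>f. at_point (fr j) e (\<lambda>x. f (mul p x)))
      = g e (at_point (fr i) e) (at_point (fr j) e)"
    using metric frame_tangent[OF assms(1)] frame_tangent[OF assms(2)]
    unfolding left_invariant_metric_def by blast
  then show ?thesis
    using orthonormal_e[OF assms] by (simp add: translate_frame assms mul_e_right inner_fields_def)
qed

lemma g_zero: "w \<in> tangent_space \<A> p \<Longrightarrow> g p (\<lambda>f. 0) w = 0"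
  using g_scale[of w p w 0] by simp

lemma g_comb_left:
  assumes w: "w \<in> tangent_space \<A> p"
  shows "g p (comb a p) w = (\<Sum>i<n. a i * g p (at_point (fr i) p) w)"
proof -
  \<comment> \<open>Additivity of g is available for tangent vectors only, so the induction needs
    every partial sum to be tangent: it is a full combination with truncated coefficients.\<close>
  have part: "(\<lambda>f. \<Sum>i<m. a i * fr i f p) \<in> tangent_space \<A> p" if "m \<le> n" for m
  proof -
    have "(\<Sum>i<n. (if i < m then a i else 0) * fr i f p) = (\<Sum>i<m. a i * fr i f p)" for f
      by (rule sum.mono_neutral_cong_right) (use that in auto)
    then show ?thesis using comb_tangent[of "\<lambda>i. if i < m then a i else 0" p] by (simp add: comb_def)
  qed
  have "g p (\<lambda>f. \<Sum>i<m. a i * fr i f p) w = (\<Sum>i<m. a i * g p (at_point (fr i) p) w)" if "m \<le> n" for m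
    using that
  proof (induction m)
    case 0
    then show ?case using g_zero[OF w] by simp
  next
    case (Suc m)
    then have m: "m < n" by simp
    have t: "at_point (fr m) p \<in> tangent_space \<A> p" by (rule frame_tangent[OF m])
    have "(\<lambda>f. a m * at_point (fr m) p f) \<in> tangent_space \<A> p"
      using comb_tangent[of "\<lambda>i. if i = m then a m else 0" p] comb_single[OF m, of "a m" p]
      by (simp add: at_point_def)
    then have "g p (\<lambda>f. (\<Sum>i<m. a i * fr i f p) + a m * at_point (fr m) p f) w
        = g p (\<lambda>f. \<Sum>i<m. a i * fr i f p) w + g p (\<lambda>f. a m * at_point (fr m) p f) w"
      using m by (intro g_add[OF part _ w]) simp
    then show ?case
      using Suc.IH m g_scale[OF t w, of "a m"] by (simp add: at_point_def)
  qed
  from this[of n] show ?thesis by (simp add: comb_def)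
qed

lemma g_comb_frame: "j < n \<Longrightarrow> g p (comb a p) (at_point (fr j) p) = a j"
  by (simp add: g_comb_left[OF frame_tangent] frame_orthonormal if_distrib[of "(*) _"] cong: if_cong)

lemma g_frame_comb: "j < n \<Longrightarrow> g p (at_point (fr j) p) (comb a p) = a j"
  using g_sym[OF frame_tangent comb_tangent] g_comb_frame by simp

lemma g_comb_comb: "g p (comb a p) (comb b p) = (\<Sum>i<n. a i * b i)"
  by (simp add: g_comb_left[OF comb_tangent] g_frame_comb)

lemma comb_cong: "(\<And>i. i < n \<Longrightarrow> a i = b i) \<Longrightarrow> comb a p = comb b p"
  unfolding comb_def by auto

text \<open>In a chart, a tangent vector is a directional derivative along a vector of \<open>'e\<close>. The
  orthonormal frame supplies \<open>DIM('e)\<close> independent directions.\<close>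

lemma tangent_eq_comb:
  assumes v: "v \<in> tangent_space \<A> p"
  obtains a where "v = comb a p"
proof -
  obtain U \<phi> where U: "(U, \<phi>) \<in> \<A>" "p \<in> U" by (rule chart_around[OF chart_atlas])
  define L where "L w f = frechet_derivative (f \<circ> inv_into U \<phi>) (at (\<phi> p)) w" for w and f :: "'g \<Rightarrow> real"
  have lin: "linear (\<lambda>w. L w f)" if f: "smooth_fun \<A> f" for f
  proof -
    have "smooth_on (\<phi> ` U) (f \<circ> inv_into U \<phi>)"
      using smooth_map_charts[OF f[unfolded smooth_fun_def] U(1), of UNIV id]
      by (simp add: standard_atlas_def)
    then have "((f \<circ> inv_into U \<phi>) has_derivative (\<lambda>w. L w f)) (at (\<phi> p))"
      unfolding L_def
      by (rule smooth_on_imp_has_derivative[OF _ chart_open_image[OF chart_atlas U(1) chart_open[OF chart_atlas U(1)] order_refl]])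
         (use U(2) in blast)
    then show ?thesis by (rule has_derivative_linear)
  qed
  have coord: "\<exists>w. \<forall>f. smooth_fun \<A> f \<longrightarrow> u f = L w f" if u: "u \<in> tangent_space \<A> p" for u
  proof -
    obtain c where c: "smooth_curve \<A> c" "c 0 = p" "u = velocity \<A> c"
      using u unfolding tangent_space_def by blast
    have "c 0 \<in> U" using c(2) U(2) by simp
    from velocity_in_chart[OF chart_atlas U(1) c(1) this]
    show ?thesis unfolding L_def c(2) c(3) by metis
  qed
  have "\<forall>i. \<exists>w. i < n \<longrightarrow> (\<forall>f. smooth_fun \<A> f \<longrightarrow> at_point (fr i) p f = L w f)"
    using coord[OF frame_tangent] by blast
  then obtain W where W: "\<And>i f. i < n \<Longrightarrow> smooth_fun \<A> f \<Longrightarrow> fr i f p = L (W i) f"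
    unfolding choice_iff at_point_def by blast
  obtain w where w: "\<And>f. smooth_fun \<A> f \<Longrightarrow> v f = L w f" using coord[OF v] by blast
  obtain b where b: "bij_betw b {..<n} (Basis :: 'e set)"
    using ex_bij_betw_nat_finite[of "Basis :: 'e set"] dim by (auto simp: atLeast0LessThan)
  \<comment> \<open>M turns frame coefficients into the chart direction of the combination.
    Orthonormality makes it injective, and as an endomorphism of \<open>'e\<close> it is then
    onto.\<close>
  define M where "M x = (\<Sum>i<n. (x \<bullet> b i) *\<^sub>R W i)" for x :: 'e
  have "linear M"
    unfolding M_def
    by (rule linearI) (simp_all add: inner_add_left scaleR_add_left sum.distrib scaleR_sum_right)
  have comb_L: "comb (\<lambda>i. x \<bullet> b i) p f = L (M x) f" if "smooth_fun \<A> f" for x f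
    unfolding M_def comb_def linear_sum[OF lin[OF that]] linear_cmul[OF lin[OF that]]
    by (rule sum.cong) (simp_all add: W that)
  have "x = 0" if "M x = 0" for x
  proof -
    have "comb (\<lambda>i. x \<bullet> b i) p f = 0" for f
    proof (cases "smooth_fun \<A> f")
      case True
      then show ?thesis using comb_L[OF True, of x] linear_0[OF lin[OF True]] that by simp
    qed (rule tangent_space_nonsmooth[OF comb_tangent])
    then have "comb (\<lambda>i. x \<bullet> b i) p = (\<lambda>f. 0)" by (rule ext)
    then have z: "x \<bullet> b i = 0" if "i < n" for i
      using g_comb_frame[OF that, of p "\<lambda>i. x \<bullet> b i"] g_zero[OF frame_tangent[OF that]] by simp
    show "x = 0"
    proof (rule euclidean_eqI)
      fix u :: 'e assume "u \<in> Basis"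
      then obtain i where "i < n" "u = b i"
        using bij_betw_imp_surj_on[OF b] by blast
      then show "x \<bullet> u = 0 \<bullet> u" using z by simp
    qed
  qed
  then have "inj M" using linear_injective_0[OF \<open>linear M\<close>] by blast
  then have "surj M" using linear_injective_imp_surjective[OF \<open>linear M\<close>] by blast
  then obtain x where x: "w = M x" by blast
  have "v f = comb (\<lambda>i. x \<bullet> b i) p f" for f
  proof (cases "smooth_fun \<A> f")
    case True
    then show ?thesis using w comb_L x by simp
  next
    case False
    then show ?thesis
      using tangent_space_nonsmooth[OF v] tangent_space_nonsmooth[OF comb_tangent] by simp
  qed
  then show ?thesis using that by blast
qed

lemma tangent_expand:
  assumes "v \<in> tangent_space \<A> p"
  shows "v = comb (\<lambda>i. g p v (at_point (fr i) p)) p"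
proof -
  obtain a where a: "v = comb a p" by (rule tangent_eq_comb[OF assms])
  show ?thesis unfolding a by (rule comb_cong) (simp add: g_comb_frame)
qed

lemma comb_eq_iff: "comb a p = comb b p \<longleftrightarrow> (\<forall>i<n. a i = b i)"
  by (metis comb_cong g_comb_frame)

definition cpt :: "'g vfield \<Rightarrow> nat \<Rightarrow> 'g \<Rightarrow> real" where
  "cpt Z i = inner_fields g Z (fr i)"

lemma at_point_expand:
  assumes "vector_field \<A> Z"
  shows "at_point Z p = comb (\<lambda>i. cpt Z i p) p"
proof -
  have "at_point Z p \<in> tangent_space \<A> p" using assms unfolding vector_field_def by blast
  then show ?thesis unfolding cpt_def inner_fields_def by (rule tangent_expand)
qed

lemma vector_field_expand:
  assumes "vector_field \<A> Z"
  shows "Z f p = (\<Sum>i<n. cpt Z i p * fr i f p)"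
  using fun_cong[OF at_point_expand[OF assms], of p f] by (simp add: at_point_def comb_def)

lemma smooth_inner: "vector_field \<A> Z \<Longrightarrow> vector_field \<A> W \<Longrightarrow> smooth_fun \<A> (inner_fields g Z W)"
  using metric unfolding left_invariant_metric_def riemannian_metric_def by blast

lemma smooth_cpt: "vector_field \<A> Z \<Longrightarrow> i < n \<Longrightarrow> smooth_fun \<A> (cpt Z i)"
  unfolding cpt_def by (rule smooth_inner[OF _ frame_vector_field])

lemma inner_fields_expand:
  assumes "vector_field \<A> Z" "vector_field \<A> W"
  shows "inner_fields g Z W p = (\<Sum>i<n. cpt Z i p * cpt W i p)"
  by (simp add: inner_fields_def at_point_expand assms g_comb_comb)

text \<open>Components can be read off from smooth test functions, because both sides vanish on all
  others.\<close>

lemma cpt_eqI: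
  assumes "\<And>f. smooth_fun \<A> f \<Longrightarrow> Z f p = (\<Sum>i<n. a i * fr i f p)" "at_point Z p \<in> tangent_space \<A> p" "k < n"
  shows "cpt Z k p = a k"
proof -
  have "at_point Z p = comb a p"
  proof
    fix f
    show "at_point Z p f = comb a p f"
      using assms(1) tangent_space_nonsmooth[OF assms(2)] tangent_space_nonsmooth[OF comb_tangent]
      by (cases "smooth_fun \<A> f") (simp_all add: at_point_def comb_def)
  qed
  then show ?thesis by (simp add: cpt_def inner_fields_def g_comb_frame assms(3))
qed

lemma cpt_frame: "i < n \<Longrightarrow> j < n \<Longrightarrow> cpt (fr i) j p = (if i = j then 1 else 0)"
  by (simp add: cpt_def inner_fields_def frame_orthonormal)

lemma vector_field_vf_zero: "vector_field \<A> vf_zero"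
  using left_invariant_comb[of "\<lambda>i. 0"] by (simp add: left_invariant_field_def vf_zero_def)

end

section \<open>Second fundamental forms of distributions spanned by frame fields\<close>

context lie_group_frame begin

text \<open>Encoding by index sets makes the orthogonal complement the passage from S to - S, so one
  formula serves the second fundamental forms of both distributions.\<close>

definition frame_distr :: "nat set \<Rightarrow> 'g distr" where
  "frame_distr S = (\<lambda>p. {v \<in> tangent_space \<A> p. \<forall>i<n. i \<notin> S \<longrightarrow> g p v (at_point (fr i) p) = 0})"

lemma frame_distr_eq: "frame_distr S p = {comb a p | a. \<forall>i<n. i \<notin> S \<longrightarrow> a i = 0}"
proof (intro equalityI subsetI)
  fix v assume v: "v \<in> frame_distr S p"
  then have "v = comb (\<lambda>i. g p v (at_point (fr i) p)) p"
    by (intro tangent_expand) (simp add: frame_distr_def)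
  with v show "v \<in> {comb a p | a. \<forall>i<n. i \<notin> S \<longrightarrow> a i = 0}"
    unfolding frame_distr_def by blast
qed (auto simp: frame_distr_def comb_tangent g_comb_frame)

lemma frame_in_frame_distr: "i < n \<Longrightarrow> i \<in> S \<Longrightarrow> at_point (fr i) p \<in> frame_distr S p"
  by (simp add: frame_distr_def frame_tangent frame_orthonormal) 

lemma orthogonal_frame_distr: "orthogonal_distr \<A> g (frame_distr S) = frame_distr (- S)"
proof (intro ext equalityI subsetI)
  fix p v assume v: "v \<in> orthogonal_distr \<A> g (frame_distr S) p"
  then show "v \<in> frame_distr (- S) p"
    using frame_in_frame_distr unfolding orthogonal_distr_def frame_distr_def by simp
next
  fix p v assume "v \<in> frame_distr (- S) p"
  then obtain a where a: "v = comb a p" "\<forall>i<n. i \<in> S \<longrightarrow> a i = 0"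
    unfolding frame_distr_eq by auto
  have "g p v w = 0" if w: "w \<in> frame_distr S p" for w
  proof -
    obtain b where b: "w = comb b p" "\<forall>i<n. i \<notin> S \<longrightarrow> b i = 0"
      using w unfolding frame_distr_eq by blast
    show ?thesis
      unfolding a(1) b(1) g_comb_comb by (rule sum.neutral) (use a(2) b(2) in auto)
  qed
  then show "v \<in> orthogonal_distr \<A> g (frame_distr S) p"
    unfolding orthogonal_distr_def a(1) by (simp add: comb_tangent)
qed

lemma proj_vec_frame_distr:
  "proj_vec g (frame_distr S) p (comb a p) = comb (\<lambda>i. if i \<in> S then a i else 0) p"
  unfolding proj_vec_def
proof (rule the_equality)
  have diff: "(\<lambda>f. comb a p f - comb b p f) = comb (\<lambda>i. a i - b i) p" for b
    by (simp add: comb_def sum_subtractf algebra_simps)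
  let ?b = "\<lambda>i. if i \<in> S then a i else 0"
  show "comb ?b p \<in> frame_distr S p \<and> (\<forall>u\<in>frame_distr S p. g p (\<lambda>f. comb a p f - comb ?b p f) u = 0)"
  proof (intro conjI ballI)
    show "comb ?b p \<in> frame_distr S p" unfolding frame_distr_eq by auto
    fix u assume "u \<in> frame_distr S p"
    then obtain c where c: "u = comb c p" "\<forall>i<n. i \<notin> S \<longrightarrow> c i = 0"
      unfolding frame_distr_eq by auto
    show "g p (\<lambda>f. comb a p f - comb ?b p f) u = 0"
      unfolding diff c(1) g_comb_comb by (rule sum.neutral) (use c(2) in auto)
  qed
  fix w assume w: "w \<in> frame_distr S p \<and> (\<forall>u\<in>frame_distr S p. g p (\<lambda>f. comb a p f - w f) u = 0)"
  then obtain c where c: "w = comb c p" "\<forall>i<n. i \<notin> S \<longrightarrow> c i = 0"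
    unfolding frame_distr_eq by auto
  have "a i - c i = 0" if "i < n" "i \<in> S" for i
    using w frame_in_frame_distr[OF that, of p] unfolding c(1) diff by (metis g_comb_frame that(1))
  then show "w = comb ?b p"
    unfolding c(1) comb_eq_iff using c(2) by simp
qed

lemma sections_frame_distr:
  "sections \<A> (frame_distr S) = {Z. vector_field \<A> Z \<and> (\<forall>i<n. i \<notin> S \<longrightarrow> cpt Z i = (\<lambda>p. 0))}"
  unfolding sections_def frame_distr_def cpt_def inner_fields_def vector_field_def by (auto simp: fun_eq_iff)

lemma frame_in_sections: "i < n \<Longrightarrow> i \<in> S \<Longrightarrow> fr i \<in> sections \<A> (frame_distr S)"
  by (simp add: sections_def frame_vector_field frame_in_frame_distr)

end

section \<open>The Koszul formula in a left-invariant frame\<close>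

locale lie_group_connection = lie_group_frame +
  fixes nabla :: "'a vfield \<Rightarrow> 'a vfield \<Rightarrow> 'a vfield" and C :: "nat \<Rightarrow> nat \<Rightarrow> nat \<Rightarrow> real"
  assumes nabla: "levi_civita \<A> g nabla"
    and structure_constants:
      "i < n \<Longrightarrow> k < n \<Longrightarrow> lie_bracket (fr i) (fr k) f p = (\<Sum>l<n. C i k l * fr l f p)"
begin

lemma
  assumes "vector_field \<A> Z" "vector_field \<A> W"
  shows vector_field_nabla: "vector_field \<A> (nabla Z W)"
    and torsion_free: "vf_diff (nabla Z W) (nabla W Z) = lie_bracket Z W"
    and metric_compatible: "vector_field \<A> U \<Longrightarrow>
      Z (inner_fields g W U) p = inner_fields g (nabla Z W) U p + inner_fields g W (nabla Z U) p"
proof -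
  have h: "smooth_fun \<A> (inner_fields g Z W)" by (rule smooth_inner[OF assms])
  have "vector_field \<A> (nabla Z W) \<and> vf_diff (nabla Z W) (nabla W Z) = lie_bracket Z W \<and>
      (\<forall>p. Z (inner_fields g W U) p = inner_fields g (nabla Z W) U p + inner_fields g W (nabla Z U) p)"
    if "vector_field \<A> U" for U
    using nabla assms that h unfolding levi_civita_def by blast
  from this[OF assms(1)] this[of U]
  show "vector_field \<A> (nabla Z W)" "vf_diff (nabla Z W) (nabla W Z) = lie_bracket Z W"
    "vector_field \<A> U \<Longrightarrow>
      Z (inner_fields g W U) p = inner_fields g (nabla Z W) U p + inner_fields g W (nabla Z U) p"
    by blast+
qed

lemma vf_diff_expand:
  assumes "vector_field \<A> Z" "vector_field \<A> W"
  shows "at_point (vf_diff Z W) p = comb (\<lambda>i. cpt Z i p - cpt W i p) p"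
  unfolding at_point_def vf_diff_def comb_def
    vector_field_expand[OF assms(1), of _ p] vector_field_expand[OF assms(2), of _ p]
  by (simp add: sum_subtractf left_diff_distrib)

lemma inner_fields_vf_diff:
  assumes "vector_field \<A> Z" "vector_field \<A> W" "vector_field \<A> U"
  shows "inner_fields g (vf_diff Z W) U p = inner_fields g Z U p - inner_fields g W U p"
  by (simp add: inner_fields_def vf_diff_expand at_point_expand assms g_comb_comb sum_subtractf left_diff_distrib)

text \<open>No curve with this velocity has to be constructed: torsion-freeness turns the bracket
  into a difference of two vector fields, which expands in the frame.\<close>

lemma bracket_tangent:
  assumes "vector_field \<A> Z" "vector_field \<A> W"
  shows "at_point (lie_bracket Z W) p \<in> tangent_space \<A> p"
  unfolding torsion_free[OF assms, symmetric]
  by (simp add: vf_diff_expand vector_field_nabla assms comb_tangent)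

text \<open>By the Leibniz rule E_k (Z f) also differentiates the coefficients of Z, whence the last
  term.\<close>

lemma bracket_frame:
  assumes Z: "vector_field \<A> Z" and k: "k < n" and l: "l < n"
  shows "cpt (lie_bracket Z (fr k)) l p = (\<Sum>i<n. cpt Z i p * C i k l) - fr k (cpt Z l) p"
proof -
  note vk = frame_vector_field[OF k]
  have v: "at_point (fr k) p \<in> tangent_space \<A> p" by (rule frame_tangent[OF k])
  have "lie_bracket Z (fr k) f p
      = (\<Sum>l<n. ((\<Sum>i<n. cpt Z i p * C i k l) - fr k (cpt Z l) p) * fr l f p)"
    if f: "smooth_fun \<A> f" for f
  proof -
    have Zf: "smooth_fun \<A> (Z f)" using Z f unfolding vector_field_def by blast
    have "at_point (fr k) p (Z f) = (\<Sum>i<n. at_point (fr k) p (cpt Z i) * fr i f p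
        + cpt Z i p * at_point (fr k) p (fr i f))"
      by (rule tangent_derivation[OF chart_atlas v Zf]) (auto intro: smooth_cpt[OF Z] frame_smooth[OF _ f]
          simp: vector_field_expand[OF Z])
    then have "lie_bracket Z (fr k) f p
        = (\<Sum>i<n. cpt Z i p * lie_bracket (fr i) (fr k) f p - fr k (cpt Z i) p * fr i f p)"
      unfolding lie_bracket_def vector_field_expand[OF Z, of "fr k f"] at_point_def
      by (simp add: sum_subtractf sum.distrib algebra_simps)
    also have "\<dots> = (\<Sum>i<n. \<Sum>l<n. cpt Z i p * C i k l * fr l f p) - (\<Sum>l<n. fr k (cpt Z l) p * fr l f p)"
      by (simp add: structure_constants k sum_subtractf sum_distrib_left mult.assoc)
    also have "(\<Sum>i<n. \<Sum>l<n. cpt Z i p * C i k l * fr l f p)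
        = (\<Sum>l<n. (\<Sum>i<n. cpt Z i p * C i k l) * fr l f p)"
      by (subst sum.swap) (simp add: sum_distrib_right)
    finally show ?thesis by (simp add: sum_subtractf left_diff_distrib)
  qed
  then show ?thesis by (intro cpt_eqI l bracket_tangent Z vk)
qed

text \<open>By torsion-freeness the left side is g([Z, E_k], W), written in the shape in which it
  enters the Koszul computation.\<close>

lemma inner_bracket_frame:
  assumes Z: "vector_field \<A> Z" and W: "vector_field \<A> W" and k: "k < n"
  shows "inner_fields g (nabla Z (fr k)) W p - inner_fields g (nabla (fr k) Z) W p
    = (\<Sum>l<n. \<Sum>i<n. cpt Z i p * cpt W l p * C i k l) - (\<Sum>l<n. fr k (cpt Z l) p * cpt W l p)"
proof -
  note vk = frame_vector_field[OF k]
  have "inner_fields g (nabla Z (fr k)) W p - inner_fields g (nabla (fr k) Z) W p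
      = inner_fields g (vf_diff (nabla Z (fr k)) (nabla (fr k) Z)) W p"
    by (rule inner_fields_vf_diff[symmetric]) (intro vector_field_nabla Z vk W)+
  also have "\<dots> = inner_fields g (lie_bracket Z (fr k)) W p"
    by (simp add: torsion_free Z vk)
  also have "\<dots> = (\<Sum>l<n. cpt (lie_bracket Z (fr k)) l p * cpt W l p)"
  proof -
    have "at_point (lie_bracket Z (fr k)) p \<in> tangent_space \<A> p" by (rule bracket_tangent[OF Z vk])
    then have "at_point (lie_bracket Z (fr k)) p = comb (\<lambda>i. cpt (lie_bracket Z (fr k)) i p) p"
      unfolding cpt_def inner_fields_def by (rule tangent_expand)
    then show ?thesis by (simp add: inner_fields_def at_point_expand[OF W] g_comb_comb)
  qed
  also have "\<dots> = (\<Sum>l<n. ((\<Sum>i<n. cpt Z i p * C i k l) - fr k (cpt Z l) p) * cpt W l p)"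
    by (rule sum.cong) (simp_all add: bracket_frame[OF Z k])
  finally show ?thesis
    by (simp add: sum_subtractf left_diff_distrib right_diff_distrib sum_distrib_left sum_distrib_right mult_ac)
qed

text \<open>Metric compatibility is applied to Z g(W, E_k), W g(Z, E_k) and E_k g(Z, W), and
  torsion-freeness exchanges the arguments of \<nabla> where E_k stands second. The derivatives
  along E_k of the coefficients, produced by the two brackets, cancel against E_k g(Z, W).\<close>

lemma koszul:
  assumes Z: "vector_field \<A> Z" and W: "vector_field \<A> W" and k: "k < n"
  shows "cpt (nabla Z W) k p + cpt (nabla W Z) k p
    = Z (cpt W k) p + W (cpt Z k) p
      - (\<Sum>i<n. \<Sum>l<n. cpt Z i p * cpt W l p * (C i k l + C l k i))"
proof -
  note vk = frame_vector_field[OF k]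
  have sym: "inner_fields g U V p = inner_fields g V U p" if "vector_field \<A> U" "vector_field \<A> V" for U V
    by (simp add: inner_fields_expand that mult.commute)
  have v: "at_point (fr k) p \<in> tangent_space \<A> p" by (rule frame_tangent[OF k])
  have "at_point (fr k) p (inner_fields g Z W)
      = (\<Sum>i<n. at_point (fr k) p (cpt Z i) * cpt W i p + cpt Z i p * at_point (fr k) p (cpt W i))"
    by (rule tangent_derivation[OF chart_atlas v smooth_inner[OF Z W]])
       (auto intro: smooth_cpt Z W simp: inner_fields_expand Z W)
  then have 1: "fr k (inner_fields g Z W) p
      = (\<Sum>i<n. fr k (cpt Z i) p * cpt W i p) + (\<Sum>i<n. fr k (cpt W i) p * cpt Z i p)"
    unfolding at_point_def by (simp add: sum.distrib mult.commute)
  have 2: "Z (cpt W k) p = cpt (nabla Z W) k p + inner_fields g W (nabla Z (fr k)) p"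
    unfolding cpt_def by (rule metric_compatible[OF Z W vk])
  have 3: "W (cpt Z k) p = cpt (nabla W Z) k p + inner_fields g Z (nabla W (fr k)) p"
    unfolding cpt_def by (rule metric_compatible[OF W Z vk])
  have 4: "fr k (inner_fields g Z W) p
      = inner_fields g (nabla (fr k) Z) W p + inner_fields g Z (nabla (fr k) W) p"
    by (rule metric_compatible[OF vk Z W])
  note 5 = inner_bracket_frame[OF Z W k, of p] and 6 = inner_bracket_frame[OF W Z k, of p]
  have 7: "(\<Sum>i<n. \<Sum>l<n. cpt Z i p * cpt W l p * (C i k l + C l k i))
      = (\<Sum>l<n. \<Sum>i<n. cpt Z i p * cpt W l p * C i k l) + (\<Sum>l<n. \<Sum>i<n. cpt W i p * cpt Z l p * C i k l)"
    by (subst (2) sum.swap) (simp add: distrib_left sum.distrib mult_ac)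
  have 8: "inner_fields g W (nabla Z (fr k)) p = inner_fields g (nabla Z (fr k)) W p"
    "inner_fields g Z (nabla W (fr k)) p = inner_fields g (nabla W (fr k)) Z p"
    "inner_fields g Z (nabla (fr k) W) p = inner_fields g (nabla (fr k) W) Z p"
    by (intro sym Z W vk vector_field_nabla)+
  show ?thesis
    using 1 2 3 4 5 6 unfolding 7 8 by linarith
qed

lemma second_form_frame_distr:
  assumes Z: "Z \<in> sections \<A> (frame_distr (- S))" and W: "W \<in> sections \<A> (frame_distr (- S))"
  shows "second_form g nabla (frame_distr S) Z W f p
    = - (\<Sum>k<n. if k \<in> S then (\<Sum>i<n. \<Sum>l<n. cpt Z i p * cpt W l p * (C i k l + C l k i)) * fr k f p else 0) / 2"
proof -
  have vZ: "vector_field \<A> Z" and vW: "vector_field \<A> W"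
    and zZ: "\<And>k. k < n \<Longrightarrow> k \<in> S \<Longrightarrow> cpt Z k = (\<lambda>p. 0)" and zW: "\<And>k. k < n \<Longrightarrow> k \<in> S \<Longrightarrow> cpt W k = (\<lambda>p. 0)"
    using Z W unfolding sections_frame_distr by auto
  \<comment> \<open>The components of Z and W with index in S vanish identically, so the derivative
    terms of the Koszul formula are derivatives of the zero function.\<close>
  have vf0: "U (\<lambda>p. 0) p = 0" if "vector_field \<A> U" for U
  proof -
    have u: "at_point U p \<in> tangent_space \<A> p" using that unfolding vector_field_def by blast
    have "smooth_fun \<A> (\<lambda>p. 0)" unfolding smooth_fun_def by (rule smooth_map_const[OF chart_atlas])
    from tangent_derivation[OF chart_atlas u this, of "{}"] show ?thesis by (simp add: at_point_def)
  qed
  have add: "at_point (vf_add (nabla Z W) (nabla W Z)) p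
      = comb (\<lambda>k. cpt (nabla Z W) k p + cpt (nabla W Z) k p) p"
    unfolding at_point_def vf_add_def comb_def
      vector_field_expand[OF vector_field_nabla[OF vZ vW], of _ p]
      vector_field_expand[OF vector_field_nabla[OF vW vZ], of _ p]
    by (simp add: sum.distrib distrib_right)
  have "second_form g nabla (frame_distr S) Z W f p
      = (\<Sum>k<n. (if k \<in> S then cpt (nabla Z W) k p + cpt (nabla W Z) k p else 0) * fr k f p) / 2"
    unfolding second_form_def vf_scale_def proj_field_def add proj_vec_frame_distr by (simp add: comb_def)
  also have "(\<Sum>k<n. (if k \<in> S then cpt (nabla Z W) k p + cpt (nabla W Z) k p else 0) * fr k f p)
      = (\<Sum>k<n. - (if k \<in> S then (\<Sum>i<n. \<Sum>l<n. cpt Z i p * cpt W l p * (C i k l + C l k i)) * fr k f p else 0))"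
    by (rule sum.cong) (auto simp: koszul vZ vW zZ zW vf0)
  finally show ?thesis by (simp add: sum_negf)
qed

lemma second_form_frame:
  assumes "i < n" "i \<notin> S" "j < n" "j \<notin> S"
  shows "second_form g nabla (frame_distr S) (fr i) (fr j) f p
    = - (\<Sum>k<n. if k \<in> S then (C i k j + C j k i) * fr k f p else 0) / 2"
proof -
  have s: "fr i \<in> sections \<A> (frame_distr (- S))" "fr j \<in> sections \<A> (frame_distr (- S))"
    using assms by (auto intro: frame_in_sections)
  have "(\<Sum>a<n. \<Sum>b<n. cpt (fr i) a p * cpt (fr j) b p * (C a k b + C b k a)) = C i k j + C j k i" for k p
  proof -
    have "(\<Sum>a<n. \<Sum>b<n. cpt (fr i) a p * cpt (fr j) b p * (C a k b + C b k a))
        = (\<Sum>a<n. \<Sum>b<n. if b = j then (if a = i then C a k b + C b k a else 0) else 0)"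
      by (intro sum.cong refl) (simp add: cpt_frame assms)
    then show ?thesis using assms by simp
  qed
  then show ?thesis unfolding second_form_frame_distr[OF s] by (simp only:)
qed

lemma sum_if_frame_eq_0D:
  assumes "\<And>f. (\<Sum>k<n. if k \<in> S then a k * fr k f p else 0) = 0" "k < n" "k \<in> S"
  shows "a k = 0"
proof -
  have "comb (\<lambda>k. if k \<in> S then a k else 0) p = comb (\<lambda>k. 0) p"
    unfolding comb_def using assms(1) by (simp add: if_distrib[of "\<lambda>x. x * _"] cong: if_cong)
  then show ?thesis unfolding comb_eq_iff using assms(2,3) by auto
qed

text \<open>Tensoriality: the second fundamental form at p sees Z and W only through their
  coefficients at p, so frame fields suffice as tests. Taken for S it is the criterion for a
  Riemannian foliation, for - S the one for a totally geodesic foliation.\<close>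

lemma second_form_frame_distr_vanishes_iff:
  "(\<forall>Z \<in> sections \<A> (frame_distr (- S)). \<forall>W \<in> sections \<A> (frame_distr (- S)).
      second_form g nabla (frame_distr S) Z W = vf_zero)
    \<longleftrightarrow> (\<forall>k<n. k \<in> S \<longrightarrow> (\<forall>i<n. i \<notin> S \<longrightarrow> (\<forall>j<n. j \<notin> S \<longrightarrow> C i k j + C j k i = 0)))"
proof
  assume L: "\<forall>Z \<in> sections \<A> (frame_distr (- S)). \<forall>W \<in> sections \<A> (frame_distr (- S)).
      second_form g nabla (frame_distr S) Z W = vf_zero"
  show "\<forall>k<n. k \<in> S \<longrightarrow> (\<forall>i<n. i \<notin> S \<longrightarrow> (\<forall>j<n. j \<notin> S \<longrightarrow> C i k j + C j k i = 0))"
  proof (intro allI impI)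
    fix k i j assume h: "k < n" "k \<in> S" "i < n" "i \<notin> S" "j < n" "j \<notin> S"
    have "fr i \<in> sections \<A> (frame_distr (- S))" "fr j \<in> sections \<A> (frame_distr (- S))"
      using h by (auto intro: frame_in_sections)
    then have "second_form g nabla (frame_distr S) (fr i) (fr j) = vf_zero" using L by blast
    then have "(\<Sum>k<n. if k \<in> S then (C i k j + C j k i) * fr k f e else 0) = 0" for f
      using second_form_frame[OF h(3-6), of f e] by (simp add: vf_zero_def)
    from sum_if_frame_eq_0D[OF this h(1,2)] show "C i k j + C j k i = 0" .
  qed
next
  assume R: "\<forall>k<n. k \<in> S \<longrightarrow> (\<forall>i<n. i \<notin> S \<longrightarrow> (\<forall>j<n. j \<notin> S \<longrightarrow> C i k j + C j k i = 0))"
  show "\<forall>Z \<in> sections \<A> (frame_distr (- S)). \<forall>W \<in> sections \<A> (frame_distr (- S)).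
      second_form g nabla (frame_distr S) Z W = vf_zero"
  proof (intro ballI ext)
    fix Z W f p assume s: "Z \<in> sections \<A> (frame_distr (- S))" "W \<in> sections \<A> (frame_distr (- S))"
    have "cpt Z i p * cpt W l p * (C i k l + C l k i) = 0" if "k < n" "k \<in> S" "i < n" "l < n" for k i l
      using s R that unfolding sections_frame_distr by (cases "i \<in> S"; cases "l \<in> S") simp_all
    then show "second_form g nabla (frame_distr S) Z W f p = vf_zero f p"
      unfolding second_form_frame_distr[OF s] vf_zero_def by (simp add: sum.neutral)
  qed
qed

section \<open>The foliation properties as linear conditions on the structure constants\<close>

lemma riemannian_iff:
  "riemannian_foliation \<A> g nabla (frame_distr S)
    \<longleftrightarrow> (\<forall>k<n. k \<in> S \<longrightarrow> (\<forall>i<n. i \<notin> S \<longrightarrow> (\<forall>j<n. j \<notin> S \<longrightarrow> C i k j + C j k i = 0)))"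
  unfolding riemannian_foliation_def orthogonal_frame_distr by (rule second_form_frame_distr_vanishes_iff)

lemma totally_geodesic_iff:
  "totally_geodesic_foliation \<A> g nabla (frame_distr S)
    \<longleftrightarrow> (\<forall>k<n. k \<notin> S \<longrightarrow> (\<forall>i<n. i \<in> S \<longrightarrow> (\<forall>j<n. j \<in> S \<longrightarrow> C i k j + C j k i = 0)))"
  unfolding totally_geodesic_foliation_def orthogonal_frame_distr
  using second_form_frame_distr_vanishes_iff[of "- S"] by simp

text \<open>The constant is c = - 2 g(N, E_k) at e, where the factor stems from the sign and the one
  half in the second fundamental form. The point is that c is the same for all i.\<close>

lemma conformal_imp:
  assumes "conformal_foliation \<A> g nabla (frame_distr S)" and k: "k < n" "k \<in> S"
  obtains c where "\<And>i j. i < n \<Longrightarrow> i \<notin> S \<Longrightarrow> j < n \<Longrightarrow> j \<notin> S \<Longrightarrow> C i k j + C j k i = (if i = j then c else 0)"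
proof -
  obtain N where N: "N \<in> sections \<A> (frame_distr S)"
    and conf: "\<And>Z W. Z \<in> sections \<A> (frame_distr (- S)) \<Longrightarrow> W \<in> sections \<A> (frame_distr (- S)) \<Longrightarrow>
      second_form g nabla (frame_distr S) Z W = vf_scale (inner_fields g Z W) N"
    using assms(1) unfolding conformal_foliation_def orthogonal_frame_distr by blast
  have vN: "vector_field \<A> N" and zN: "\<And>i. i < n \<Longrightarrow> i \<notin> S \<Longrightarrow> cpt N i e = 0"
    using N unfolding sections_frame_distr by auto
  show ?thesis
  proof (rule that)
    fix i j assume h: "i < n" "i \<notin> S" "j < n" "j \<notin> S"
    let ?d = "if i = j then 1 else 0 :: real"
    have s: "fr i \<in> sections \<A> (frame_distr (- S))" "fr j \<in> sections \<A> (frame_distr (- S))"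
      using h by (auto intro: frame_in_sections)
    have "(\<Sum>k<n. if k \<in> S then (C i k j + C j k i + 2 * ?d * cpt N k e) * fr k f e else 0) = 0" for f
    proof -
      have "second_form g nabla (frame_distr S) (fr i) (fr j) f e = ?d * N f e"
        using conf[OF s] orthonormal_e[OF h(1,3)] by (simp add: vf_scale_def)
      also have "N f e = (\<Sum>k<n. if k \<in> S then cpt N k e * fr k f e else 0)"
        unfolding vector_field_expand[OF vN, of f e] by (rule sum.cong) (auto simp: zN)
      finally have "(\<Sum>k<n. if k \<in> S then (C i k j + C j k i) * fr k f e else 0)
          + 2 * ?d * (\<Sum>k<n. if k \<in> S then cpt N k e * fr k f e else 0) = 0"
        unfolding second_form_frame[OF h] by simp
      moreover have "2 * ?d * (\<Sum>k<n. if k \<in> S then cpt N k e * fr k f e else 0)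
          = (\<Sum>k<n. if k \<in> S then 2 * ?d * cpt N k e * fr k f e else 0)"
        unfolding sum_distrib_left by (rule sum.cong) auto
      ultimately show ?thesis
        by (simp only: sum.distrib[symmetric]) (simp add: distrib_right if_distrib cong: if_cong) 
    qed
    from sum_if_frame_eq_0D[OF this k]
    show "C i k j + C j k i = (if i = j then - 2 * cpt N k e else 0)" by auto
  qed
qed

lemma riemannian_imp_conformal:
  assumes "riemannian_foliation \<A> g nabla (frame_distr S)"
  shows "conformal_foliation \<A> g nabla (frame_distr S)"
  unfolding conformal_foliation_def
proof (intro bexI[of _ vf_zero] ballI)
  show "vf_zero \<in> sections \<A> (frame_distr S)"
  proof -
    have "cpt vf_zero i = (\<lambda>p. 0)" if "i < n" for i
      using g_zero[OF frame_tangent[OF that]] by (simp add: cpt_def inner_fields_def at_point_def vf_zero_def fun_eq_iff)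
    then show ?thesis unfolding sections_frame_distr by (simp add: vector_field_vf_zero)
  qed
next
  fix Z W
  assume "Z \<in> sections \<A> (orthogonal_distr \<A> g (frame_distr S))"
    "W \<in> sections \<A> (orthogonal_distr \<A> g (frame_distr S))"
  then have "second_form g nabla (frame_distr S) Z W = vf_zero"
    using assms unfolding riemannian_foliation_def by blast
  then show "second_form g nabla (frame_distr S) Z W = vf_scale (inner_fields g Z W) vf_zero"
    by (simp add: vf_scale_def vf_zero_def)
qed

text \<open>An orthonormal basis of \<open>V p\<close> is carried to the frame of \<open>V p\<close> by an orthogonal matrix, so
  it has the same trace.\<close>

lemma minimal_iff:
  assumes S: "S \<subseteq> {..<n}"
  shows "minimal_foliation \<A> g nabla (frame_distr S) \<longleftrightarrow> (\<forall>k<n. k \<notin> S \<longrightarrow> (\<Sum>i\<in>S. C i k i) = 0)"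
proof
  have finS: "finite S" using S finite_subset by blast
  assume L: "minimal_foliation \<A> g nabla (frame_distr S)"
  \<comment> \<open>The trace condition is tested at e on the frame fields themselves.\<close>
  define Es where "Es = map fr (sorted_list_of_set S)"
  let ?is = "sorted_list_of_set S"
  have set: "set ?is = S" and dist: "distinct ?is" using finS by auto
  have nth: "?is ! a < n" "?is ! a \<in> S" if "a < length ?is" for a
    using nth_mem[OF that] set S by auto
  have "set Es \<subseteq> sections \<A> (frame_distr S)"
    unfolding Es_def using S finS by (auto intro!: frame_in_sections)
  moreover have "orthonormal_at g e Es"
    unfolding orthonormal_at_def Es_def using nth dist
    by (auto simp: orthonormal_e nth_eq_iff_index_eq)
  moreover have "frame_distr S e = generated_distr (field_span Es) e"
  proof (intro equalityI subsetI)
    fix v assume "v \<in> frame_distr S e"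
    then obtain a where a: "v = comb a e" "\<forall>i<n. i \<notin> S \<longrightarrow> a i = 0" unfolding frame_distr_eq by auto
    have "comb a e = at_point (lincomb (map a ?is) Es) e"
    proof
      fix f
      have "comb a e f = (\<Sum>i\<in>S. a i * fr i f e)"
        unfolding comb_def by (rule sum.mono_neutral_right) (use S a(2) in auto)
      also have "\<dots> = (\<Sum>i<length ?is. a (?is ! i) * fr (?is ! i) f e)"
        by (rule sum.reindex_bij_betw[symmetric, OF bij_betw_nth[OF dist _ set[symmetric]]]) simp
      finally show "comb a e f = at_point (lincomb (map a ?is) Es) e f"
        by (simp add: at_point_def lincomb_def Es_def)
    qed
    then show "v \<in> generated_distr (field_span Es) e"
      unfolding a(1) generated_distr_def field_span_def
      by (intro image_eqI[of _ _ "lincomb (map a ?is) Es"]) (auto simp: Es_def)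
  next
    fix v assume "v \<in> generated_distr (field_span Es) e"
    then obtain as where v: "v = at_point (lincomb as Es) e" unfolding generated_distr_def field_span_def by auto
    define a where "a i = (\<Sum>j<length ?is. if ?is ! j = i then as ! j else 0)" for i
    have "v = comb a e"
    proof
      fix f
      have "comb a e f = (\<Sum>j<length ?is. \<Sum>i<n. if ?is ! j = i then as ! j * fr i f e else 0)"
        unfolding comb_def a_def sum_distrib_right by (subst sum.swap) (intro sum.cong refl, simp)
      also have "\<dots> = (\<Sum>j<length ?is. as ! j * fr (?is ! j) f e)"
        by (rule sum.cong) (use nth in auto)
      finally show "v f = comb a e f" by (simp add: v at_point_def lincomb_def Es_def)
    qed
    moreover have "a i = 0" if "i \<notin> S" for i
      unfolding a_def by (rule sum.neutral) (use that nth(2) in auto)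
    ultimately show "v \<in> frame_distr S e" unfolding frame_distr_eq by blast
  qed
  ultimately have tr: "(\<Sum>E\<leftarrow>Es. second_form g nabla (frame_distr (- S)) E E f e) = 0" for f
    using L unfolding minimal_foliation_def orthogonal_frame_distr by blast
  show "\<forall>k<n. k \<notin> S \<longrightarrow> (\<Sum>i\<in>S. C i k i) = 0"
  proof (intro allI impI)
    fix k assume k: "k < n" "k \<notin> S"
    have "(\<Sum>k<n. if k \<in> - S then (\<Sum>i\<in>S. C i k i) * fr k f e else 0) = 0" for f
    proof -
      have "0 = (\<Sum>i\<in>S. second_form g nabla (frame_distr (- S)) (fr i) (fr i) f e)"
        using tr[of f] unfolding Es_def by (simp add: comp_def sum_list_distinct_conv_sum_set dist set)
      also have "\<dots> = (\<Sum>i\<in>S. - (\<Sum>k<n. if k \<in> - S then C i k i * fr k f e else 0))"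
      proof (rule sum.cong)
        fix i assume "i \<in> S"
        then have i: "i < n" "i \<notin> - S" using S by auto
        have "(\<Sum>k<n. if k \<in> - S then (C i k i + C i k i) * fr k f e else 0)
            = 2 * (\<Sum>k<n. if k \<in> - S then C i k i * fr k f e else 0)"
          unfolding sum_distrib_left by (rule sum.cong) auto
        then show "second_form g nabla (frame_distr (- S)) (fr i) (fr i) f e
            = - (\<Sum>k<n. if k \<in> - S then C i k i * fr k f e else 0)"
          unfolding second_form_frame[OF i i] by simp
      qed simp
      also have "\<dots> = - (\<Sum>k<n. if k \<in> - S then (\<Sum>i\<in>S. C i k i) * fr k f e else 0)"
        unfolding sum_negf by (subst sum.swap) (auto simp: sum_distrib_right intro!: sum.cong)
      finally show ?thesis by simp
    qed
    from sum_if_frame_eq_0D[OF this] k show "(\<Sum>i\<in>S. C i k i) = 0" by simp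
  qed
next
  assume R: "\<forall>k<n. k \<notin> S \<longrightarrow> (\<Sum>i\<in>S. C i k i) = 0"
  show "minimal_foliation \<A> g nabla (frame_distr S)"
    unfolding minimal_foliation_def orthogonal_frame_distr
  proof (intro allI impI, elim conjE)
    fix p Es f
    assume sec: "set Es \<subseteq> sections \<A> (frame_distr S)" and on: "orthonormal_at g p Es"
      and span: "frame_distr S p = generated_distr (field_span Es) p"
    let ?m = "length Es"
    define E where "E a i = cpt (Es ! a) i p" for a i
    have secE: "Es ! a \<in> sections \<A> (frame_distr S)" if "a < ?m" for a using sec nth_mem[OF that] by blast
    have vE: "vector_field \<A> (Es ! a)" if "a < ?m" for a using secE[OF that] unfolding sections_def by blast
    have zE: "E a i = 0" if "a < ?m" "i < n" "i \<notin> S" for a i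
      using secE[OF that(1)] that unfolding sections_frame_distr E_def by simp
    \<comment> \<open>Orthonormality of Es says that the rows of E are orthonormal, whereas the
      trace needs its columns. This comes from the spanning assumption: the coefficients of a frame
      vector in Es are its inner products with the members of Es.\<close>
    have par: "(\<Sum>a<?m. E a i * E a j) = (if i = j then 1 else 0)" if i: "i < n" "i \<in> S" and j: "j < n" for i j
    proof -
      obtain c where c: "at_point (fr i) p = at_point (lincomb c Es) p"
        using frame_in_frame_distr[OF i, of p] unfolding span generated_distr_def field_span_def by auto
      have "at_point (lincomb c Es) p = comb (\<lambda>l. \<Sum>a<?m. c ! a * E a l) p"
      proof
        fix f
        have "(\<Sum>a<?m. c ! a * (Es ! a) f p) = (\<Sum>a<?m. \<Sum>l<n. c ! a * E a l * fr l f p)"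
          by (rule sum.cong) (simp_all add: vector_field_expand[OF vE, of _ f p] E_def sum_distrib_left mult.assoc)
        also have "\<dots> = (\<Sum>l<n. (\<Sum>a<?m. c ! a * E a l) * fr l f p)"
          by (subst sum.swap) (simp add: sum_distrib_right)
        finally show "at_point (lincomb c Es) p f = comb (\<lambda>l. \<Sum>a<?m. c ! a * E a l) p f"
          by (simp add: at_point_def lincomb_def comb_def)
      qed
      then have "comb (\<lambda>l. \<Sum>a<?m. c ! a * E a l) p = comb (\<lambda>l. if l = i then 1 else 0) p"
        using c by (simp only: frame_eq_comb[OF i(1)])
      then have ci: "(\<Sum>a<?m. c ! a * E a l) = (if l = i then 1 else 0)" if "l < n" for l
        using that unfolding comb_eq_iff by blast
      have ca: "c ! b = E b i" if b: "b < ?m" for b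
      proof -
        have on': "(\<Sum>l<n. E a l * E b l) = (if a = b then 1 else 0)" if "a < ?m" for a
          using on that b inner_fields_expand[OF vE[OF that] vE[OF b], of p]
          unfolding orthonormal_at_def E_def by simp
        have "E b i = (\<Sum>l<n. (if l = i then 1 else 0) * E b l)" using i by (simp add: if_distrib[of "\<lambda>x. x * _"] cong: if_cong)
        also have "\<dots> = (\<Sum>l<n. (\<Sum>a<?m. c ! a * E a l) * E b l)"
          by (rule sum.cong) (simp_all add: ci)
        also have "\<dots> = (\<Sum>a<?m. c ! a * (\<Sum>l<n. E a l * E b l))"
          unfolding sum_distrib_right sum_distrib_left by (subst sum.swap) (simp add: mult.assoc)
        also have "\<dots> = (\<Sum>a<?m. c ! a * (if a = b then 1 else 0))"
          by (rule sum.cong) (simp_all add: on')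
        also have "\<dots> = c ! b" using b by (simp add: if_distrib[of "(*) _"] cong: if_cong)
        finally show ?thesis by simp
      qed
      show ?thesis using ci[OF j] by (simp add: ca eq_commute)
    qed
    have par': "(\<Sum>a<?m. E a i * E a j) = (if i = j \<and> i \<in> S then 1 else 0)" if "i < n" "j < n" for i j
    proof (cases "i \<in> S")
      case False
      then have "(\<Sum>a<?m. E a i * E a j) = 0" by (intro sum.neutral) (simp add: zE that)
      then show ?thesis using False by simp
    qed (simp add: par that)
    have "(\<Sum>E\<leftarrow>Es. second_form g nabla (frame_distr (- S)) E E f p)
        = (\<Sum>a<?m. second_form g nabla (frame_distr (- S)) (Es ! a) (Es ! a) f p)"
      by (simp add: sum_list_sum_nth atLeast0LessThan)
    also have "\<dots> = (\<Sum>a<?m. - (\<Sum>k<n. if k \<in> - S then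
        (\<Sum>i<n. \<Sum>l<n. E a i * E a l * (C i k l + C l k i)) * fr k f p else 0) / 2)"
    proof (rule sum.cong)
      fix a assume "a \<in> {..<?m}"
      then have "Es ! a \<in> sections \<A> (frame_distr (- (- S)))" using secE by simp
      from second_form_frame_distr[OF this this, of f p]
      show "second_form g nabla (frame_distr (- S)) (Es ! a) (Es ! a) f p = - (\<Sum>k<n. if k \<in> - S then
        (\<Sum>i<n. \<Sum>l<n. E a i * E a l * (C i k l + C l k i)) * fr k f p else 0) / 2"
        unfolding E_def .
    qed simp
    also have "\<dots> = - (\<Sum>k<n. \<Sum>a<?m. if k \<in> - S then
        (\<Sum>i<n. \<Sum>l<n. E a i * E a l * (C i k l + C l k i)) * fr k f p else 0) / 2"
      by (subst sum.swap) (simp add: sum_negf sum_divide_distrib)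
    also have "(\<Sum>k<n. \<Sum>a<?m. if k \<in> - S then
        (\<Sum>i<n. \<Sum>l<n. E a i * E a l * (C i k l + C l k i)) * fr k f p else 0) = 0"
    proof (rule sum.neutral, rule ballI)
      fix k assume k: "k \<in> {..<n}"
      show "(\<Sum>a<?m. if k \<in> - S then
        (\<Sum>i<n. \<Sum>l<n. E a i * E a l * (C i k l + C l k i)) * fr k f p else 0) = 0"
      proof (cases "k \<in> S")
        case False
        have "(\<Sum>a<?m. \<Sum>i<n. \<Sum>l<n. E a i * E a l * (C i k l + C l k i))
            = (\<Sum>i<n. \<Sum>l<n. (\<Sum>a<?m. E a i * E a l) * (C i k l + C l k i))"
          unfolding sum_distrib_right
          by (subst sum.swap) (rule sum.cong[OF refl sum.swap])
        also have "\<dots> = (\<Sum>i<n. \<Sum>l<n. if l = i then (if i \<in> S then 2 * C i k i else 0) else 0)"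
          by (intro sum.cong refl) (simp add: par')
        also have "\<dots> = (\<Sum>i<n. if i \<in> S then 2 * C i k i else 0)" by simp
        also have "\<dots> = 2 * (\<Sum>i\<in>S. C i k i)"
          unfolding sum_distrib_left by (rule sum.mono_neutral_cong_right) (use S in auto)
        finally have "(\<Sum>a<?m. \<Sum>i<n. \<Sum>l<n. E a i * E a l * (C i k l + C l k i)) = 0"
          using R k False by simp
        then have "(\<Sum>a<?m. (\<Sum>i<n. \<Sum>l<n. E a i * E a l * (C i k l + C l k i)) * fr k f p) = 0"
          unfolding sum_distrib_right[symmetric] by (simp only: mult_zero_left)
        then show ?thesis using False by (simp only: Compl_iff not_False_eq_True if_True)
      qed simp
    qed
    finally show "(\<Sum>E\<leftarrow>Es. second_form g nabla (frame_distr (- S)) E E f p) = 0" by simp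
  qed
qed

end

section \<open>The adjoint action of a periodic one-parameter subgroup\<close>

lemma DERIV_along_line:
  fixes K :: "'a::euclidean_space \<Rightarrow> real"
  assumes "smooth_on UNIV K"
  shows "((\<lambda>t. K (x + t *\<^sub>R v)) has_real_derivative frechet_derivative K (at (x + t *\<^sub>R v)) v) (at t)"
proof -
  have hK: "(K has_derivative frechet_derivative K (at y)) (at y)" for y
    by (rule smooth_on_imp_has_derivative[OF assms]) simp_all
  have "((\<lambda>t. x + t *\<^sub>R v) has_derivative (\<lambda>s. s *\<^sub>R v)) (at t)"
    by (auto intro!: derivative_eq_intros)
  from has_derivative_compose[OF this hK]
  show ?thesis
    unfolding has_field_derivative_def
    by (rule has_derivative_eq_rhs)
       (simp add: fun_eq_iff linear_cmul[OF has_derivative_linear[OF hK]] mult.commute)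
qed

text \<open>The function h = v (a v + b w) is - v v', and it is nonincreasing because a^2 + c b
  \<ge> 0. Periodicity makes it constant, so v' = 0 and v is constant; since its antiderivative u is
  periodic, v is zero. The last step treats the degenerate case a^2 + c b = 0 together with the
  hyperbolic one.\<close>

lemma periodic_ode_vanishes:
  fixes u v w :: "real \<Rightarrow> real"
  assumes P: "0 < P" and per: "u P = u 0" "v P = v 0" "w P = w 0"
    and u: "\<And>t. (u has_real_derivative v t) (at t)"
    and v: "\<And>t. (v has_real_derivative - (a * v t + b * w t)) (at t)"
    and w: "\<And>t. (w has_real_derivative - (c * v t - a * w t)) (at t)"
    and nonneg: "0 \<le> a\<^sup>2 + c * b"
  shows "v 0 = 0"
proof -
  define h where "h t = v t * (a * v t + b * w t)" for t
  define h' where "h' t = - ((a * v t + b * w t)\<^sup>2 + (a\<^sup>2 + c * b) * (v t)\<^sup>2)" for t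
  have dh: "(h has_real_derivative h' t) (at t)" for t
    unfolding h_def[abs_def] h'_def
    by (rule DERIV_cong[OF DERIV_mult[OF v DERIV_add[OF DERIV_cmult[OF v] DERIV_cmult[OF w]]]])
       (simp add: power2_eq_square algebra_simps)
  have h'_le: "h' t \<le> 0" for t
    using mult_nonneg_nonneg[OF nonneg zero_le_power2[of "v t"]] zero_le_power2[of "a * v t + b * w t"]
    unfolding h'_def by linarith
  have anti: "h t \<le> h s" if "s \<le> t" for s t
    using DERIV_nonpos_imp_nonincreasing[OF that, of h] dh h'_le by blast
  have "h t = h 0" if "0 < t" "t < P" for t
    using anti[of 0 t] anti[of t P] that per by (simp add: h_def)
  then have "h' t = 0" if "0 < t" "t < P" for t
  proof -
    have "\<forall>\<^sub>F s in nhds t. h s = h 0"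
      by (rule eventually_nhds[THEN iffD2], rule exI[of _ "{0<..<P}"]) (use \<open>\<And>t. 0 < t \<Longrightarrow> t < P \<Longrightarrow> h t = h 0\<close> that in auto)
    then have "((\<lambda>s. h 0) has_real_derivative h' t) (at t)"
      using dh[of t] by (simp add: DERIV_cong_ev)
    then show ?thesis using DERIV_unique[OF _ DERIV_const] by blast
  qed
  then have "a * v t + b * w t = 0" if "0 < t" "t < P" for t
  proof -
    have "(a * v t + b * w t)\<^sup>2 = 0"
      using \<open>\<And>t. 0 < t \<Longrightarrow> t < P \<Longrightarrow> h' t = 0\<close>[OF that] mult_nonneg_nonneg[OF nonneg zero_le_power2[of "v t"]]
        zero_le_power2[of "a * v t + b * w t"] unfolding h'_def by linarith
    then show ?thesis by simp
  qed
  then have dv: "DERIV v t :> 0" if "0 < t" "t < P" for t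
    using v[of t] that by simp
  have "continuous_on {0..P} v"
    by (intro continuous_at_imp_continuous_on ballI DERIV_isCont[OF v])
  from DERIV_isconst2[OF P this dv] have const: "v t = v 0" if "0 \<le> t" "t \<le> P" for t
    using that by blast
  obtain z where z: "0 < z" "z < P" "u P - u 0 = (P - 0) * v z"
    using MVT2[OF P, of u v] u by blast
  then show ?thesis using const[of z] per P by simp
qed

context lie_group_frame begin

lemma left_invariantD:
  "left_invariant_field \<A> mul Z \<Longrightarrow> smooth_fun \<A> f \<Longrightarrow> Z (\<lambda>x. f (mul a x)) p = Z f (mul a p)"
  unfolding left_invariant_field_def by blast

lemma left_invariant_smooth: "left_invariant_field \<A> mul Z \<Longrightarrow> smooth_fun \<A> f \<Longrightarrow> smooth_fun \<A> (Z f)"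
  unfolding left_invariant_field_def vector_field_def by blast

text \<open>Left invariance carries the velocity of d from e to q.\<close>

lemma left_invariant_derivative:
  assumes Z: "left_invariant_field \<A> mul Z" and d: "smooth_curve \<A> d" "at_point Z e = velocity \<A> d"
    and f: "smooth_fun \<A> f"
  shows "((\<lambda>s. f (mul q (d s))) has_real_derivative Z f q) (at 0)"
proof -
  have "velocity \<A> d (\<lambda>x. f (mul q x)) = at_point Z e (\<lambda>x. f (mul q x))" by (simp add: d(2))
  also have "\<dots> = Z f q"
    using left_invariantD[OF Z f, of q e] by (simp add: at_point_def mul_e_right)
  finally show ?thesis
    using has_derivative_along_curve[OF chart_atlas smooth_fun_left_translate[OF f, of q] d(1)] by simp
qed

end

locale one_parameter_subgroup = lie_group_frame +
  fixes \<gamma> :: "real \<Rightarrow> 'a" and T :: "'a vfield"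
  assumes smooth_curve: "smooth_curve \<A> \<gamma>"
    and hom: "\<gamma> (s + t) = mul (\<gamma> s) (\<gamma> t)"
    and zero: "\<gamma> 0 = e"
    and T: "left_invariant_field \<A> mul T" and T_e: "at_point T e = velocity \<A> \<gamma>"
begin

text \<open>Right translation by \<gamma> is the flow of T: the homomorphism law shifts the
  derivative from parameter 0 to t.\<close>

lemma derivative_along_orbit:
  assumes "smooth_fun \<A> f"
  shows "((\<lambda>s. f (mul q (\<gamma> s))) has_real_derivative T f (mul q (\<gamma> t))) (at t)"
proof -
  have "((\<lambda>s. f (mul (mul q (\<gamma> t)) (\<gamma> s))) has_real_derivative T f (mul q (\<gamma> t))) (at 0)"
    by (rule left_invariant_derivative[OF T smooth_curve T_e assms])
  then have "((\<lambda>s. f (mul q (\<gamma> (s + t)))) has_real_derivative T f (mul q (\<gamma> t))) (at 0)"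
    by (simp add: mul_assoc hom[symmetric] add.commute)
  then show ?thesis
    using DERIV_shift[of "\<lambda>s. f (mul q (\<gamma> s))" _ 0 t] by simp
qed

text \<open>Right translations by \<gamma>(s) and \<gamma>(t) commute, and those by \<gamma>(s) form
  the flow of T.\<close>

lemma field_right_translate:
  assumes "smooth_fun \<A> f"
  shows "T (\<lambda>x. f (mul x (\<gamma> t))) = (\<lambda>x. T f (mul x (\<gamma> t)))"
proof
  fix q
  have "((\<lambda>s. f (mul (mul q (\<gamma> s)) (\<gamma> t))) has_real_derivative T (\<lambda>x. f (mul x (\<gamma> t))) (mul q (\<gamma> 0))) (at 0)"
    by (rule derivative_along_orbit[OF smooth_fun_right_translate[OF assms]])
  moreover have "((\<lambda>s. f (mul (mul q (\<gamma> t)) (\<gamma> s))) has_real_derivative T f (mul (mul q (\<gamma> t)) (\<gamma> 0))) (at 0)"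
    by (rule derivative_along_orbit[OF assms])
  moreover have "mul (mul q (\<gamma> s)) (\<gamma> t) = mul (mul q (\<gamma> t)) (\<gamma> s)" for s
    by (simp add: mul_assoc hom[symmetric] add.commute)
  ultimately show "T (\<lambda>x. f (mul x (\<gamma> t))) q = T f (mul q (\<gamma> t))"
    using DERIV_unique by (simp add: zero mul_e_right) 
qed

text \<open>The tangent vector \<open>Ad(\<gamma>(-t)) Z\<^sub>e\<close>, applied to a function.\<close>

definition adjoint :: "'a vfield \<Rightarrow> ('a \<Rightarrow> real) \<Rightarrow> real \<Rightarrow> real" where
  "adjoint Z f t = Z (\<lambda>x. f (mul x (\<gamma> t))) (\<gamma> (- t))"

text \<open>With \<open>d\<close> a curve of velocity \<open>Z\<^sub>e\<close>, the mixed partial derivatives of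
  \<open>K(a, b, s) = f(\<gamma>(a) d(s) \<gamma>(b))\<close> at \<open>s = 0\<close> are \<open>T Z f\<close> for \<open>a, s\<close> and \<open>Z T f\<close> for \<open>b, s\<close>.\<close>

lemma adjoint_derivative:
  assumes Z: "left_invariant_field \<A> mul Z" and f: "smooth_fun \<A> f"
  shows "(adjoint Z f has_real_derivative - adjoint (lie_bracket T Z) f t) (at t)"
proof -
  have "at_point Z e \<in> tangent_space \<A> e"
    using Z unfolding left_invariant_field_def vector_field_def by blast
  then obtain d where d: "smooth_curve \<A> d" "d 0 = e" "at_point Z e = velocity \<A> d"
    unfolding tangent_space_def by blast
  define K where "K x = f (mul (\<gamma> (fst x)) (mul (d (snd (snd x))) (\<gamma> (fst (snd x)))))" for x :: "real \<times> real \<times> real"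
  have sc: "smooth_map standard_atlas \<A> (\<lambda>x. c (L x))"
    if "smooth_curve \<A> c" "bounded_linear L" for c and L :: "real \<times> real \<times> real \<Rightarrow> real"
    by (rule smooth_map_compose[OF chart_atlas_standard chart_atlas_standard chart_atlas
          smooth_map_bounded_linear[OF that(2)] that(1)[unfolded smooth_curve_def]])
  have "smooth_fun standard_atlas K"
    unfolding K_def
    by (intro smooth_fun_compose[OF chart_atlas_standard chart_atlas _ f] smooth_map_mul chart_atlas_standard
        sc smooth_curve d(1) bounded_linear_fst bounded_linear_snd bounded_linear_compose[OF bounded_linear_fst]
        bounded_linear_compose[OF bounded_linear_snd])
  then have sK: "smooth_on UNIV K" by (simp add: smooth_fun_def smooth_map_standard_iff)
  define D where "D v = (\<lambda>x. frechet_derivative K (at x) v)" for v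
  have sD: "smooth_on UNIV (D v)" for v
    unfolding D_def by (rule smooth_on_frechet_derivative[OF sK])
  have dir: "frechet_derivative F (at x) v = r"
    if "smooth_on UNIV F" "((\<lambda>s. F (x + s *\<^sub>R v)) has_real_derivative r) (at 0)"
    for F :: "real \<times> real \<times> real \<Rightarrow> real" and x v r
    using DERIV_unique[OF DERIV_along_line[OF that(1), of x v 0] that(2)] by simp
  have D3: "D (0, 0, 1) (a, b, 0) = Z (\<lambda>x. f (mul x (\<gamma> b))) (\<gamma> a)" for a b
    unfolding D_def
    by (rule dir[OF sK])
       (use left_invariant_derivative[OF Z d(1,3) smooth_fun_right_translate[OF f, of "\<gamma> b"], of "\<gamma> a"]
         in \<open>simp add: K_def mul_assoc\<close>)
  have D2: "D (0, 1, 0) (a, b, s) = T f (mul (\<gamma> a) (mul (d s) (\<gamma> b)))" for a b s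
  proof -
    have "((\<lambda>r. f (mul (mul (\<gamma> a) (d s)) (\<gamma> (b + r)))) has_real_derivative T f (mul (mul (\<gamma> a) (d s)) (\<gamma> b))) (at 0)"
      using DERIV_shift[of "\<lambda>r. f (mul (mul (\<gamma> a) (d s)) (\<gamma> r))" _ 0 b]
        derivative_along_orbit[OF f, of "mul (\<gamma> a) (d s)" b] by (simp add: add.commute)
    then show ?thesis
      unfolding D_def by (intro dir[OF sK]) (simp add: K_def mul_assoc)
  qed
  let ?f = "\<lambda>x. f (mul x (\<gamma> t))"
  have sf: "smooth_fun \<A> ?f" by (rule smooth_fun_right_translate[OF f])
  \<comment> \<open>\<open>adjoint Z f t\<close> is the s-derivative of K at this point, so
    differentiating it in t means differentiating in direction (- 1, 1, 0).\<close>
  let ?x = "(- t, t, 0) :: real \<times> real \<times> real"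
  have D31: "frechet_derivative (D (0, 0, 1)) (at ?x) (1, 0, 0) = T (Z ?f) (\<gamma> (- t))"
  proof (rule dir[OF sD])
    have "((\<lambda>s. Z ?f (mul e (\<gamma> s))) has_real_derivative T (Z ?f) (mul e (\<gamma> (- t)))) (at (- t))"
      by (rule derivative_along_orbit[OF left_invariant_smooth[OF Z sf]])
    then show "((\<lambda>s. D (0, 0, 1) (?x + s *\<^sub>R (1, 0, 0))) has_real_derivative T (Z ?f) (\<gamma> (- t))) (at 0)"
      using DERIV_shift[of "\<lambda>s. Z ?f (\<gamma> s)" _ 0 "- t"] by (simp add: D3 mul_e_left add.commute)
  qed
  \<comment> \<open>In \<open>D (0, 0, 1)\<close> the variable b sits inside the function to which Z
    is applied. Symmetry of second derivatives allows the b-derivative to be taken first, where it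
    is T f along the curve.\<close>
  have D32: "frechet_derivative (D (0, 0, 1)) (at ?x) (0, 1, 0) = Z (T ?f) (\<gamma> (- t))"
  proof -
    have "frechet_derivative (D (0, 0, 1)) (at ?x) (0, 1, 0) = frechet_derivative (D (0, 1, 0)) (at ?x) (0, 0, 1)"
      unfolding D_def by (rule second_derivative_symmetric[OF sK])
    also have "\<dots> = Z (T ?f) (\<gamma> (- t))"
    proof (rule dir[OF sD])
      have "((\<lambda>s. T ?f (mul (\<gamma> (- t)) (d s))) has_real_derivative Z (T ?f) (\<gamma> (- t))) (at 0)"
        by (rule left_invariant_derivative[OF Z d(1,3) left_invariant_smooth[OF T sf]])
      then show "((\<lambda>s. D (0, 1, 0) (?x + s *\<^sub>R (0, 0, 1))) has_real_derivative Z (T ?f) (\<gamma> (- t))) (at 0)"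
        by (simp add: D2 field_right_translate[OF f] mul_assoc)
    qed
    finally show ?thesis .
  qed
  have lin: "linear (frechet_derivative (D (0, 0, 1)) (at ?x))"
    by (rule has_derivative_linear[OF smooth_on_imp_has_derivative[OF sD]]) simp_all
  have "frechet_derivative (D (0, 0, 1)) (at ?x) (- 1, 1, 0) = - T (Z ?f) (\<gamma> (- t)) + Z (T ?f) (\<gamma> (- t))"
    using linear_add[OF lin, of "(- 1) *\<^sub>R (1, 0, 0)" "(0, 1, 0)"] linear_cmul[OF lin, of "- 1" "(1, 0, 0)"]
    by (simp add: D31 D32)
  then have "frechet_derivative (D (0, 0, 1)) (at ((0, 0, 0) + t *\<^sub>R (- 1, 1, 0))) (- 1, 1, 0)
      = - adjoint (lie_bracket T Z) f t"
    by (simp add: adjoint_def lie_bracket_def)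
  with DERIV_along_line[OF sD, of "(0, 0, 1)" "(0, 0, 0)" "(- 1, 1, 0)" t]
  have "((\<lambda>t. D (0, 0, 1) (- t, t, 0)) has_real_derivative - adjoint (lie_bracket T Z) f t) (at t)"
    by simp
  moreover have "(\<lambda>t. D (0, 0, 1) (- t, t, 0)) = adjoint Z f"
    by (simp add: fun_eq_iff D3 adjoint_def)
  ultimately show ?thesis by simp
qed

lemma adjoint_0: "adjoint Z f 0 = Z f e"
  by (simp add: adjoint_def zero mul_e_right)

lemma adjoint_periodic:
  assumes "\<gamma> P = e"
  shows "adjoint Z f P = adjoint Z f 0"
proof -
  have "\<gamma> (- P) = e"
    using hom[of "- P" P] by (simp add: assms zero mul_e_right)
  then show ?thesis by (simp add: adjoint_def assms zero mul_e_right)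
qed

text \<open>If \<open>a\<^sup>2 + c b \<ge> 0\<close>, the matrix of \<open>ad T\<close> on the span of \<open>X, Y\<close> modulo the centralizer of \<open>T\<close>
  has real eigenvalues, which is incompatible with periodicity of \<open>Ad(\<gamma>)\<close> unless \<open>ad T\<close> vanishes.\<close>

lemma periodic_bracket_vanishes:
  assumes P: "0 < P" "\<gamma> P = e" and nonneg: "0 \<le> a\<^sup>2 + c * b"
    and inv: "left_invariant_field \<A> mul X" "left_invariant_field \<A> mul Y"
      "\<And>i. i \<in> I \<Longrightarrow> left_invariant_field \<A> mul (Q i)"
    and TX: "\<And>f p. lie_bracket T X f p = a * X f p + b * Y f p + (\<Sum>i\<in>I. q i * Q i f p)"
    and TY: "\<And>f p. lie_bracket T Y f p = c * X f p - a * Y f p + (\<Sum>i\<in>I. r i * Q i f p)"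
    and TQ: "\<And>i. i \<in> I \<Longrightarrow> lie_bracket T (Q i) = vf_zero"
    and f: "smooth_fun \<A> f"
  shows "lie_bracket T X f e = 0"
proof -
  define v where "v t = - adjoint (lie_bracket T X) f t" for t
  define w where "w t = - adjoint (lie_bracket T Y) f t" for t
  have dX: "(adjoint X f has_real_derivative v t) (at t)" for t
    unfolding v_def by (rule adjoint_derivative[OF inv(1) f])
  have dY: "(adjoint Y f has_real_derivative w t) (at t)" for t
    unfolding w_def by (rule adjoint_derivative[OF inv(2) f])
  have dQ: "(adjoint (Q i) f has_real_derivative 0) (at t)" if "i \<in> I" for i t
    using adjoint_derivative[OF inv(3)[OF that] f, of t] by (simp add: TQ[OF that] adjoint_def vf_zero_def)
  have dS: "((\<lambda>t. \<Sum>i\<in>I. k i * adjoint (Q i) f t) has_real_derivative 0) (at t)" for k t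
    by (rule DERIV_cong[OF DERIV_sum[OF DERIV_cmult[OF dQ]]]) simp_all
  \<comment> \<open>The terms with Q i make the system for \<open>adjoint X f\<close> and
    \<open>adjoint Y f\<close> inhomogeneous. They are constant in t because T commutes with Q i, so
    the derivatives v and w satisfy the homogeneous system.\<close>
  have v_eq: "v = (\<lambda>t. - (a * adjoint X f t + b * adjoint Y f t + (\<Sum>i\<in>I. q i * adjoint (Q i) f t)))"
    unfolding v_def adjoint_def TX by simp
  have w_eq: "w = (\<lambda>t. - (c * adjoint X f t - a * adjoint Y f t + (\<Sum>i\<in>I. r i * adjoint (Q i) f t)))"
    unfolding w_def adjoint_def TY by simp
  have dv: "(v has_real_derivative - (a * v t + b * w t)) (at t)" for t
    by (subst v_eq)
       (rule DERIV_cong[OF DERIV_minus[OF DERIV_add[OF DERIV_add[OF DERIV_cmult[OF dX] DERIV_cmult[OF dY]] dS]]], simp)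
  have dw: "(w has_real_derivative - (c * v t - a * w t)) (at t)" for t
    by (subst w_eq)
       (rule DERIV_cong[OF DERIV_minus[OF DERIV_add[OF DERIV_diff[OF DERIV_cmult[OF dX] DERIV_cmult[OF dY]] dS]]], simp)
  have "v 0 = 0"
    by (rule periodic_ode_vanishes[OF P(1) adjoint_periodic[OF P(2)] _ _ dX dv dw nonneg])
       (simp_all add: v_def w_def adjoint_periodic[OF P(2)])
  then show ?thesis by (simp add: v_def adjoint_0)
qed

end

section \<open>The circle subgroup\<close>

definition rot_gen :: "real^2^2" where
  "rot_gen = (\<chi> i j. if i = j then 0 else if i = 1 then -1 else 1)"

text \<open>Rotation by the angle s, expressed through constant matrices to fit
  \<open>smooth_on_cos_sin\<close>.\<close>

definition rot :: "real \<Rightarrow> real^2^2" where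
  "rot s = cos s *\<^sub>R mat 1 + sin s *\<^sub>R rot_gen"

lemma rot_add: "rot (s + t) = rot s ** rot t"
  by (simp add: rot_def rot_gen_def vec_eq_iff forall_2 matrix_matrix_mult_def sum_2 mat_def cos_add sin_add
      algebra_simps)

lemma rot_0: "rot 0 = mat 1"
  by (simp add: rot_def)

lemma rot_in_SO2: "rot s \<in> SO2"
proof -
  have c: "cos s * cos s + sin s * sin s = 1"
    using sin_cos_squared_add[of s] by (simp add: power2_eq_square)
  then show ?thesis
    by (simp add: SO2_def rot_def rot_gen_def orthogonal_matrix vec_eq_iff forall_2 matrix_matrix_mult_def sum_2 mat_def
      transpose_def det_2 algebra_simps)
qed

lemma SO2_form:
  assumes "R \<in> SO2"
  shows "(R $ 1 $ 1)\<^sup>2 + (R $ 2 $ 1)\<^sup>2 = 1" "R = (R $ 1 $ 1) *\<^sub>R mat 1 + (R $ 2 $ 1) *\<^sub>R rot_gen"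
proof -
  have o: "R $ 1 $ 1 * R $ 1 $ 1 + R $ 2 $ 1 * R $ 2 $ 1 = 1"
    "R $ 1 $ 1 * R $ 1 $ 2 + R $ 2 $ 1 * R $ 2 $ 2 = 0"
    and d: "R $ 1 $ 1 * R $ 2 $ 2 - R $ 1 $ 2 * R $ 2 $ 1 = 1"
    using assms by (auto simp: SO2_def orthogonal_matrix vec_eq_iff forall_2 matrix_matrix_mult_def sum_2 mat_def
      transpose_def det_2)
  show "(R $ 1 $ 1)\<^sup>2 + (R $ 2 $ 1)\<^sup>2 = 1" using o(1) by (simp add: power2_eq_square)
  have "R $ 2 $ 2 = R $ 1 $ 1" "R $ 1 $ 2 = - R $ 2 $ 1" using o d by algebra+
  then show "R = (R $ 1 $ 1) *\<^sub>R mat 1 + (R $ 2 $ 1) *\<^sub>R rot_gen"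
    by (simp add: rot_gen_def vec_eq_iff forall_2 mat_def)
qed

text \<open>Differentiating the relation R11^2 + R21^2 = 1 at the identity gives zero for the
  derivative of R11; by \<open>SO2_form\<close> a multiple of \<open>rot_gen\<close>
  remains.\<close>

lemma SO2_curve_derivative:
  assumes R: "\<And>t. R t \<in> SO2" "R 0 = mat 1" and d: "(R has_vector_derivative R') (at 0)"
  obtains r where "R' = r *\<^sub>R rot_gen"
proof -
  have e: "((\<lambda>t. R t $ i $ j) has_real_derivative R' $ i $ j) (at 0)" for i j
  proof -
    have "bounded_linear (\<lambda>M :: real^2^2. M $ i $ j)"
      by (intro bounded_linear_compose[OF bounded_linear_vec_nth] bounded_linear_vec_nth)
    from bounded_linear.has_vector_derivative[OF this d]
    show ?thesis by (simp add: has_real_derivative_iff_has_vector_derivative)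
  qed
  have "((\<lambda>t. R t $ 1 $ 1 * R t $ 1 $ 1 + R t $ 2 $ 1 * R t $ 2 $ 1) has_real_derivative
      2 * R' $ 1 $ 1) (at 0)"
    by (rule DERIV_cong[OF DERIV_add[OF DERIV_mult[OF e e] DERIV_mult[OF e e]]]) (simp add: R(2) mat_def)
  moreover have "(\<lambda>t. R t $ 1 $ 1 * R t $ 1 $ 1 + R t $ 2 $ 1 * R t $ 2 $ 1) = (\<lambda>t. 1)"
    using SO2_form(1)[OF R(1)] by (simp add: power2_eq_square)
  ultimately have z: "R' $ 1 $ 1 = 0"
    using DERIV_unique[OF _ DERIV_const] by fastforce
  have f: "R t = (R t $ 1 $ 1) *\<^sub>R mat 1 + (R t $ 2 $ 1) *\<^sub>R rot_gen" for t
    by (rule SO2_form(2)[OF R(1)])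
  have "((\<lambda>t. (R t $ 1 $ 1) *\<^sub>R mat 1 + (R t $ 2 $ 1) *\<^sub>R rot_gen) has_vector_derivative
      (R' $ 1 $ 1) *\<^sub>R mat 1 + (R' $ 2 $ 1) *\<^sub>R rot_gen) (at 0)"
    using has_vector_derivative_add[OF has_vector_derivative_scaleR[OF e has_vector_derivative_const]
        has_vector_derivative_scaleR[OF e has_vector_derivative_const]] by simp
  then have "(R has_vector_derivative (R' $ 2 $ 1) *\<^sub>R rot_gen) (at 0)"
    unfolding f[symmetric] z by simp
  then have "R' = (R' $ 2 $ 1) *\<^sub>R rot_gen" by (rule vector_derivative_unique_at[OF d])
  then show ?thesis by (rule that)
qed

definition rot_curve :: "real \<Rightarrow> real \<Rightarrow> mat_pair" where
  "rot_curve r t = (mat 1, rot (r * t))"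

lemma mat_1_in_SU2: "mat 1 \<in> SU2"
proof -
  have "(\<chi> i j. cnj ((mat 1 :: complex^2^2) $ j $ i)) = mat 1"
    by (simp add: vec_eq_iff mat_def)
  then show ?thesis by (simp add: SU2_def)
qed

lemma mat_1_in_SO2: "mat 1 \<in> SO2"
  using rot_in_SO2[of 0] by (simp add: rot_0)

lemma smooth_rot_curve: "smooth_curve_in (SU2 \<times> SO2) (rot_curve r)"
proof -
  have "rot_curve r = (\<lambda>t. cos (r * t) *\<^sub>R (0, mat 1) + sin (r * t) *\<^sub>R (0, rot_gen) + (mat 1, 0))"
    by (simp add: fun_eq_iff rot_curve_def rot_def)
  then have "smooth_on UNIV (rot_curve r)" by (simp only: smooth_on_cos_sin)
  moreover have "range (rot_curve r) \<subseteq> SU2 \<times> SO2"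
    using mat_1_in_SU2 rot_in_SO2 by (auto simp: rot_curve_def)
  ultimately show ?thesis unfolding smooth_curve_in_def by blast
qed

lemma rot_curve_derivative: "(rot_curve r has_vector_derivative (0, r *\<^sub>R rot_gen)) (at 0)"
proof -
  have "((\<lambda>t. rot (r * t)) has_vector_derivative r *\<^sub>R rot_gen) (at 0)"
    unfolding rot_def has_vector_derivative_def
    by (auto intro!: derivative_eq_intros simp: fun_eq_iff mult.commute)
  from has_vector_derivative_Pair[OF has_vector_derivative_const this]
  show ?thesis by (simp add: rot_curve_def[abs_def])
qed

context lie_group_frame begin

text \<open>The squared length of u - v is zero. The hypotheses are what the metric formula of
  \<open>standard_subgroup\<close> delivers for two curves with equal derivatives in matrix
  space.\<close>

lemma tangent_eqI:
  assumes "u \<in> tangent_space \<A> p" "v \<in> tangent_space \<A> p" "g p u v = g p u u" "g p v v = g p u u"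
  shows "u = v"
proof -
  obtain a where a: "u = comb a p" by (rule tangent_eq_comb[OF assms(1)])
  obtain b where b: "v = comb b p" by (rule tangent_eq_comb[OF assms(2)])
  have "(\<Sum>i<n. (a i - b i)\<^sup>2) = g p u u - 2 * g p u v + g p v v"
    unfolding a b g_comb_comb
    by (simp add: power2_eq_square algebra_simps sum.distrib sum_subtractf sum_distrib_left)
  then have "(\<Sum>i<n. (a i - b i)\<^sup>2) = 0" using assms(3,4) by simp
  then have "\<forall>i<n. a i = b i" by (simp add: sum_nonneg_eq_0_iff)
  then show ?thesis unfolding a b comb_eq_iff .
qed

text \<open>By the formula for the metric on the subgroup, a field of the Lie algebra of \<open>SO(2)\<close> has at \<open>e\<close>
  the velocity of a rotation \<open>t \<mapsto> \<iota>(1, rot (r t))\<close>, since it pairs with it like with itself.\<close>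

lemma circle_subgroup:
  fixes \<iota> :: "mat_pair \<Rightarrow> 'g"
  assumes std: "standard_subgroup \<A> mul g \<iota>"
    and T: "T \<in> subgroup_lie_algebra \<A> mul e \<iota> ({mat 1} \<times> SO2)" and nz: "g e (at_point T e) (at_point T e) \<noteq> 0"
  obtains \<gamma> P where "one_parameter_subgroup \<A> mul e iv g fr n \<gamma> T" "0 < P" "\<gamma> P = e"
proof -
  obtain c where inv: "left_invariant_field \<A> mul T" and c: "smooth_curve_in ({mat 1} \<times> SO2) c" "c 0 = (mat 1, mat 1)"
    and Tc: "at_point T e = velocity \<A> (\<iota> \<circ> c)"
    using T unfolding subgroup_lie_algebra_def lie_algebra_def by blast
  have hom: "\<iota> (M ** M', R ** R') = mul (\<iota> (M, R)) (\<iota> (M', R'))"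
    if "M \<in> SU2" "R \<in> SO2" "M' \<in> SU2" "R' \<in> SO2" for M R M' R'
    using std that unfolding standard_subgroup_def by blast
  have sm: "smooth_map_on_subset (SU2 \<times> SO2) \<A> \<iota>"
    using std unfolding standard_subgroup_def by blast
  have met: "g (\<iota> (c 0)) (velocity \<A> (\<iota> \<circ> c)) (velocity \<A> (\<iota> \<circ> d)) =
          (vector_derivative c (at 0) \<bullet> vector_derivative d (at 0)) / 2"
    if "smooth_curve_in (SU2 \<times> SO2) c" "smooth_curve_in (SU2 \<times> SO2) d" "c 0 = d 0" for c d
    using std that unfolding standard_subgroup_def by blast
  have c': "smooth_curve_in (SU2 \<times> SO2) c"
    using c(1) mat_1_in_SU2 unfolding smooth_curve_in_def by auto
  have sc: "smooth_on UNIV c" and rc: "c t \<in> {mat 1} \<times> SO2" for t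
    using c(1) unfolding smooth_curve_in_def by auto
  \<comment> \<open>The map \<iota> is only assumed multiplicative; the image of the unit is
    idempotent, hence e.\<close>
  have ie: "\<iota> (mat 1, mat 1) = e"
  proof -
    let ?i = "\<iota> (mat 1, mat 1)"
    have "mul ?i ?i = ?i"
      using hom[OF mat_1_in_SU2 mat_1_in_SO2 mat_1_in_SU2 mat_1_in_SO2] by simp
    then have "mul (mul (iv ?i) ?i) ?i = mul (iv ?i) ?i" by (simp add: mul_assoc)
    then show ?thesis by (simp add: mul_iv_left mul_e_left)
  qed
  have dc: "(c has_vector_derivative vector_derivative c (at 0)) (at 0)"
    using smooth_on_imp_has_derivative[OF sc, of 0] differentiableI
    by (auto simp: vector_derivative_works[symmetric])
  have d1: "((\<lambda>t. fst (c t)) has_vector_derivative fst (vector_derivative c (at 0))) (at 0)"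
    and d2: "((\<lambda>t. snd (c t)) has_vector_derivative snd (vector_derivative c (at 0))) (at 0)"
    using bounded_linear.has_vector_derivative[OF bounded_linear_fst dc]
      bounded_linear.has_vector_derivative[OF bounded_linear_snd dc] by simp_all
  have "(\<lambda>t. fst (c t)) = (\<lambda>t. mat 1)" using rc by (auto simp: mem_Times_iff)
  then have f0: "fst (vector_derivative c (at 0)) = 0"
    using d1 vector_derivative_unique_at[OF _ has_vector_derivative_const] by fastforce
  have "snd (c t) \<in> SO2" for t using rc[of t] by (simp add: mem_Times_iff)
  then obtain r where r: "snd (vector_derivative c (at 0)) = r *\<^sub>R rot_gen"
    using SO2_curve_derivative[OF _ _ d2] c(2) by auto
  let ?d = "rot_curve r"
  have vd: "vector_derivative ?d (at 0) = vector_derivative c (at 0)"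
    using vector_derivative_at[OF rot_curve_derivative[of r]] f0 r by (metis prod.collapse)
  have d0: "?d 0 = (mat 1, mat 1)" by (simp add: rot_curve_def rot_0)
  define \<gamma> where "\<gamma> = \<iota> \<circ> ?d"
  have sg: "smooth_curve \<A> \<gamma>" "smooth_curve \<A> (\<iota> \<circ> c)"
    unfolding \<gamma>_def by (rule smooth_curve_on_subset[OF chart_atlas sm], rule smooth_rot_curve c')+
  have \<gamma>0: "\<gamma> 0 = e" by (simp add: \<gamma>_def d0 ie)
  have tan: "velocity \<A> \<gamma> \<in> tangent_space \<A> e" "velocity \<A> (\<iota> \<circ> c) \<in> tangent_space \<A> e"
    unfolding tangent_space_def using sg \<gamma>0 c(2) ie by auto
  let ?q = "(vector_derivative c (at 0) \<bullet> vector_derivative c (at 0)) / 2"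
  have m: "g e (velocity \<A> (\<iota> \<circ> c)) (velocity \<A> (\<iota> \<circ> c)) = ?q"
    "g e (velocity \<A> (\<iota> \<circ> c)) (velocity \<A> \<gamma>) = ?q"
    "g e (velocity \<A> \<gamma>) (velocity \<A> \<gamma>) = ?q"
    using met[OF c' c'] met[OF c' smooth_rot_curve[of r]] met[OF smooth_rot_curve[of r] smooth_rot_curve[of r]]
    by (simp_all add: \<gamma>_def c(2) d0 ie vd)
  have Te: "at_point T e = velocity \<A> \<gamma>"
    unfolding Tc by (rule tangent_eqI[OF tan(2,1)]) (simp_all add: m)
  \<comment> \<open>For r = 0 the metric formula would give T length zero at e. Its sign is left
    open, hence the absolute value in the period.\<close>
  have "r \<noteq> 0"
  proof
    assume "r = 0"
    then have "vector_derivative c (at 0) = 0" using f0 r by (simp add: prod_eq_iff)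
    then show False using nz m(1) unfolding Tc by simp
  qed
  have \<gamma>_hom: "\<gamma> (s + t) = mul (\<gamma> s) (\<gamma> t)" for s t
    using hom[OF mat_1_in_SU2 rot_in_SO2 mat_1_in_SU2 rot_in_SO2, of "r * s" "r * t"]
    by (simp add: \<gamma>_def rot_curve_def distrib_left rot_add)
  have "one_parameter_subgroup \<A> mul e iv g fr n \<gamma> T"
    by (unfold_locales) (fact sg(1) \<gamma>_hom \<gamma>0 inv Te)+
  moreover have "0 < 2 * pi / \<bar>r\<bar>" using \<open>r \<noteq> 0\<close> by simp
  moreover have "\<gamma> (2 * pi / \<bar>r\<bar>) = e"
  proof -
    have "r * (2 * pi / \<bar>r\<bar>) = 2 * pi \<or> r * (2 * pi / \<bar>r\<bar>) = - (2 * pi)"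
      using \<open>r \<noteq> 0\<close> by (auto simp: abs_if)
    then have "rot (r * (2 * pi / \<bar>r\<bar>)) = mat 1" by (elim disjE) (simp_all add: rot_def)
    then show ?thesis by (simp add: \<gamma>_def rot_curve_def ie)
  qed
  ultimately show ?thesis by (rule that)
qed

end

section \<open>Structure constants\<close>

text \<open>For \<open>i < k\<close>, entry \<open>(i, k)\<close> lists the coordinates of \<open>[E\<^sub>i, E\<^sub>k]\<close> in the basis \<open>E = (A, B, C, T, X, Y)\<close>.\<close>

definition bracket_table ::
  "real \<Rightarrow> real \<Rightarrow> real \<Rightarrow> real \<Rightarrow> real \<Rightarrow> real \<Rightarrow> real \<Rightarrow> real \<Rightarrow> real \<Rightarrow> real \<Rightarrow> real \<Rightarrow> real \<Rightarrow> real \<Rightarrow> real \<Rightarrow>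
    real list list list" where
  "bracket_table b11 b21 c11 c12 c21 c22 x1 x2 y1 \<rho> \<theta>1 \<theta>2 \<theta>3 \<theta>4 =
    [[[], [0, 0, 2, 0, 0, 0], [0, - 2, 0, 0, 0, 0], [0, 0, 0, 0, 0, 0], [0, - b11, - c11, 0, 0, 0], [0, - b21, - c21, 0, 0, 0]],
     [[], [], [2, 0, 0, 0, 0, 0], [0, 0, 0, 0, 0, 0], [b11, 0, - c12, 0, 0, 0], [b21, 0, - c22, 0, 0, 0]],
     [[], [], [], [0, 0, 0, 0, 0, 0], [c11, c12, 0, 0, 0, 0], [c21, c22, 0, 0, 0, 0]],
     [[], [], [], [],
      [1/2 * (- c12 * x1 - c22 * y1), 1/2 * (c11 * x1 + c21 * y1), 1/2 * (- b11 * x1 - b21 * y1), 0, x1, y1],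
      [1/2 * (- c12 * x2 + c22 * x1), 1/2 * (c11 * x2 - c21 * x1), 1/2 * (- b11 * x2 + b21 * x1), - \<rho>, x2, - x1]],
     [[], [], [], [], [], [\<theta>1, \<theta>2, \<theta>3, \<theta>4, \<rho>, 0]]]"

text \<open>Entries below the diagonal come from antisymmetry and the diagonal is zero, so the empty
  lists that pad \<open>bracket_table\<close> are never read.\<close>

definition antisym_table :: "real list list list \<Rightarrow> nat \<Rightarrow> nat \<Rightarrow> nat \<Rightarrow> real" where
  "antisym_table U i k l = (if i < k then U ! i ! k ! l else if k < i then - (U ! k ! i ! l) else 0)"

lemma all_less_6: "(\<forall>i<6. P i) \<longleftrightarrow> P 0 \<and> P 1 \<and> P 2 \<and> P 3 \<and> P 4 \<and> P (5 :: nat)"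
proof -
  have "{..<6} = {0, 1, 2, 3, 4, 5 :: nat}" by auto
  then have "(\<forall>i\<in>{..<6}. P i) \<longleftrightarrow> P 0 \<and> P 1 \<and> P 2 \<and> P 3 \<and> P 4 \<and> P (5 :: nat)" by simp
  then show ?thesis by (simp only: Ball_def lessThan_iff)
qed

lemma sum_less_6: "(\<Sum>i<6. h i) = h 0 + h 1 + h 2 + h 3 + h 4 + (h (5 :: nat) :: real)"
proof -
  have "{..<6} = {0, 1, 2, 3, 4, 5 :: nat}" by auto
  then show ?thesis by simp
qed

lemma lie_bracket_antisym: "lie_bracket W Z f p = - lie_bracket Z W f p"
  by (simp add: lie_bracket_def)

lemma lie_bracket_self: "lie_bracket Z Z f p = 0"
  by (simp add: lie_bracket_def)

theorem theorem6p2: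
  fixes \<A> :: "('g::{t2_space,second_countable_topology}, real^6) chart set"
    and mul :: "'g \<Rightarrow> 'g \<Rightarrow> 'g" and e :: 'g and iv :: "'g \<Rightarrow> 'g"
    and g :: "'g metric"
    and nabla :: "'g vfield \<Rightarrow> 'g vfield \<Rightarrow> 'g vfield"
    and \<iota> :: "mat_pair \<Rightarrow> 'g"
    and A B C T X Y :: "'g vfield"
    and b11 b21 c11 c12 c21 c22 x1 x2 y1 \<rho> \<theta>1 \<theta>2 \<theta>3 \<theta>4 :: real
    and \<V> :: "'g distr"
  assumes "lie_group \<A> mul e iv"
    and "left_invariant_metric \<A> mul g"
    and "levi_civita \<A> g nabla"
    and "standard_subgroup \<A> mul g \<iota>"
    and "lie_algebra \<A> mul = field_span [A, B, C, T, X, Y]"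
    and "orthonormal_at g e [A, B, C, T, X, Y]"
    and "subgroup_lie_algebra \<A> mul e \<iota> (SU2 \<times> {mat 1}) = field_span [A, B, C]"
    and "subgroup_lie_algebra \<A> mul e \<iota> ({mat 1} \<times> SO2) = field_span [T]"
    and "\<theta>1 = 1/2 * (- \<rho> * c12 + b11 * c21 - b21 * c11)"
    and "\<theta>2 = 1/2 * (\<rho> * c11 + b11 * c22 - b21 * c12)"
    and "\<theta>3 = 1/2 * (- \<rho> * b11 + c11 * c22 - c12 * c21)"
    and "lie_bracket A B = lincomb [2] [C]"
    and "lie_bracket C A = lincomb [2] [B]"
    and "lie_bracket B C = lincomb [2] [A]"
    and "lie_bracket T A = vf_zero"
    and "lie_bracket T B = vf_zero"
    and "lie_bracket T C = vf_zero"
    and "lie_bracket A X = lincomb [- b11, - c11] [B, C]"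
    and "lie_bracket A Y = lincomb [- b21, - c21] [B, C]"
    and "lie_bracket B X = lincomb [b11, - c12] [A, C]"
    and "lie_bracket B Y = lincomb [b21, - c22] [A, C]"
    and "lie_bracket C X = lincomb [c11, c12] [A, B]"
    and "lie_bracket C Y = lincomb [c21, c22] [A, B]"
    and "lie_bracket T X = lincomb
           [x1, y1,
            1/2 * (- c12 * x1 - c22 * y1),
            1/2 * (c11 * x1 + c21 * y1),
            1/2 * (- b11 * x1 - b21 * y1)]
           [X, Y, A, B, C]"
    and "lie_bracket T Y = lincomb
           [x2, - x1,
            1/2 * (- c12 * x2 + c22 * x1),
            1/2 * (c11 * x2 - c21 * x1),
            1/2 * (- b11 * x2 + b21 * x1),
            - \<rho>]
           [X, Y, A, B, C, T]"
    and "lie_bracket X Y = lincomb [\<rho>, \<theta>1, \<theta>2, \<theta>3, \<theta>4] [X, A, B, C, T]"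
    and "\<V> = generated_distr (field_span [A, B, C, T])"
  shows "(conformal_foliation \<A> g nabla \<V> \<longleftrightarrow> y1 + x2 = 0 \<and> x1 = 0)
       \<and> (riemannian_foliation \<A> g nabla \<V> \<longleftrightarrow> conformal_foliation \<A> g nabla \<V>)
       \<and> (minimal_foliation \<A> g nabla \<V> \<longleftrightarrow> \<rho> = 0)
       \<and> (totally_geodesic_foliation \<A> g nabla \<V> \<longleftrightarrow>
            \<rho> = 0 \<and> y1 * b11 = 0 \<and> y1 * b21 = 0 \<and> y1 * c11 = 0 \<and>
            y1 * c12 = 0 \<and> y1 * c21 = 0 \<and> y1 * c22 = 0)"
proof -
  define L where "L = [A, B, C, T, X, Y]"
  define U where "U = bracket_table b11 b21 c11 c12 c21 c22 x1 x2 y1 \<rho> \<theta>1 \<theta>2 \<theta>3 \<theta>4"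
  \<comment> \<open>The positions of A, B, C, T in L; X and Y have the positions 4 and 5.\<close>
  define S :: "nat set" where "S = {0, 1, 2, 3}"
  have lincomb: "lincomb (map a [0..<6]) L = (\<lambda>f p. \<Sum>i<6. a i * (L ! i) f p)" for a
  proof -
    have "length L = 6" by (simp add: L_def)
    then show ?thesis by (auto simp: lincomb_def fun_eq_iff intro!: sum.cong)
  qed
  interpret lie_group_frame \<A> mul e iv g "nth L" 6
  proof
    show "left_invariant_field \<A> mul (\<lambda>f p. \<Sum>i<6. a i * (L ! i) f p)" for a
    proof -
      have "length (map a [0..<6]) = length L" by (simp add: L_def)
      then have "lincomb (map a [0..<6]) L \<in> field_span L" unfolding field_span_def by blast
      then show ?thesis
        using assms(5) unfolding lincomb L_def[symmetric] lie_algebra_def by blast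
    qed
    show "inner_fields g (L ! i) (L ! j) e = (if i = j then 1 else 0)" if "i < 6" "j < 6" for i j
      using assms(6) that unfolding L_def[symmetric] orthonormal_at_def by (simp add: L_def)
  qed (use assms(1,2) in simp_all)
  have br: "lie_bracket A B f p = 2 * C f p" "lie_bracket A C f p = - 2 * B f p" "lie_bracket B C f p = 2 * A f p"
    "lie_bracket A T f p = 0" "lie_bracket B T f p = 0" "lie_bracket C T f p = 0"
    "lie_bracket A X f p = - b11 * B f p - c11 * C f p" "lie_bracket A Y f p = - b21 * B f p - c21 * C f p"
    "lie_bracket B X f p = b11 * A f p - c12 * C f p" "lie_bracket B Y f p = b21 * A f p - c22 * C f p"
    "lie_bracket C X f p = c11 * A f p + c12 * B f p" "lie_bracket C Y f p = c21 * A f p + c22 * B f p"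
    "lie_bracket T X f p = x1 * X f p + y1 * Y f p + 1/2 * (- c12 * x1 - c22 * y1) * A f p
      + 1/2 * (c11 * x1 + c21 * y1) * B f p + 1/2 * (- b11 * x1 - b21 * y1) * C f p"
    "lie_bracket T Y f p = x2 * X f p - x1 * Y f p + 1/2 * (- c12 * x2 + c22 * x1) * A f p
      + 1/2 * (c11 * x2 - c21 * x1) * B f p + 1/2 * (- b11 * x2 + b21 * x1) * C f p - \<rho> * T f p"
    "lie_bracket X Y f p = \<rho> * X f p + \<theta>1 * A f p + \<theta>2 * B f p + \<theta>3 * C f p + \<theta>4 * T f p"
    for f p
    using assms(12-26) lie_bracket_antisym[of A C f p] lie_bracket_antisym[of A T f p]
      lie_bracket_antisym[of B T f p] lie_bracket_antisym[of C T f p]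
    by (simp_all add: lincomb_def vf_zero_def lessThan_nat_numeral lessThan_Suc)
  have table: "\<forall>i<6. \<forall>k<6. i < k \<longrightarrow> lie_bracket (L ! i) (L ! k) f p = (\<Sum>l<6. U ! i ! k ! l * (L ! l) f p)" for f p
    unfolding all_less_6 sum_less_6 by (simp add: L_def U_def bracket_table_def br)
  interpret lie_group_connection \<A> mul e iv g "nth L" 6 nabla "antisym_table U"
  proof
    fix i k :: nat and f p assume ik: "i < 6" "k < 6"
    consider "i < k" | "k < i" | "i = k" by linarith
    then show "lie_bracket (L ! i) (L ! k) f p = (\<Sum>l<6. antisym_table U i k l * (L ! l) f p)"
    proof cases
      case 1
      then show ?thesis using table ik by (simp add: antisym_table_def)
    next
      case 2
      then have "lie_bracket (L ! k) (L ! i) f p = (\<Sum>l<6. U ! k ! i ! l * (L ! l) f p)"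
        using table ik by blast
      with 2 show ?thesis
        by (simp add: lie_bracket_antisym[of "L ! i" "L ! k"] antisym_table_def sum_negf)
    next
      case 3
      then show ?thesis by (simp add: antisym_table_def lie_bracket_self)
    qed
  qed (rule assms(3))
  have V: "\<V> = frame_distr S"
  proof (intro ext equalityI subsetI)
    fix p v assume "v \<in> \<V> p"
    then obtain as where as: "v = at_point (lincomb as [A, B, C, T]) p"
      unfolding assms(27) generated_distr_def field_span_def by auto
    have "v = comb (\<lambda>i. if i \<in> S then as ! i else 0) p"
      unfolding as comb_def sum_less_6
      by (simp add: fun_eq_iff at_point_def lincomb_def S_def L_def numeral_2_eq_2 numeral_3_eq_3)
    then show "v \<in> frame_distr S p" unfolding frame_distr_eq by auto
  next
    fix p v assume "v \<in> frame_distr S p"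
    then obtain a where a: "v = comb a p" "\<forall>i<6. i \<notin> S \<longrightarrow> a i = 0" unfolding frame_distr_eq by auto
    then have "a 4 = 0" "a 5 = 0" by (simp_all add: S_def)
    then have "v = at_point (lincomb [a 0, a 1, a 2, a 3] [A, B, C, T]) p"
      unfolding a(1) comb_def sum_less_6
      by (simp add: fun_eq_iff at_point_def lincomb_def L_def lessThan_nat_numeral lessThan_Suc)
    then show "v \<in> \<V> p"
      unfolding assms(27) generated_distr_def field_span_def
      by (intro image_eqI[of _ _ "lincomb [a 0, a 1, a 2, a 3] [A, B, C, T]"]) (auto intro!: exI[of _ "[a 0, a 1, a 2, a 3]"])
  qed
  note C_simps = antisym_table_def U_def bracket_table_def S_def
  \<comment> \<open>Only k = 3 contributes, since the brackets of A, B, C with X, Y lie in su(2).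
    For T the pairs (X, X), (Y, Y), (X, Y) give - 2 x1, 2 x1 and - (y1 + x2).\<close>
  have riem: "riemannian_foliation \<A> g nabla \<V> \<longleftrightarrow> y1 + x2 = 0 \<and> x1 = 0"
    unfolding V riemannian_iff all_less_6 by (auto simp: C_simps)
  have conf: "y1 + x2 = 0 \<and> x1 = 0" if cf: "conformal_foliation \<A> g nabla \<V>"
  proof -
    \<comment> \<open>The T-component decides. As ad T is trace-free on m modulo k, the entries for
      (X, X) and (Y, Y) are opposite; both equal c, so c = 0 and the condition is already the
      Riemannian one.\<close>
    have "3 < (6::nat)" "3 \<in> S" by (simp_all add: S_def)
    then obtain c where c: "\<And>i j. i < 6 \<Longrightarrow> i \<notin> S \<Longrightarrow> j < 6 \<Longrightarrow> j \<notin> S \<Longrightarrow>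
        antisym_table U i 3 j + antisym_table U j 3 i = (if i = j then c else 0)"
      using conformal_imp[OF cf[unfolded V]] by blast
    show ?thesis
      using c[of 4 4] c[of 5 5] c[of 4 5] by (simp add: C_simps)
  qed
  \<comment> \<open>The diagonal terms from A, B, C vanish, and so does the T-component of [T, X];
    what remains is the T-component - \<rho> of [T, Y].\<close>
  have mini: "minimal_foliation \<A> g nabla \<V> \<longleftrightarrow> \<rho> = 0"
  proof -
    have "S \<subseteq> {..<6}" by (auto simp: S_def)
    then show ?thesis unfolding V minimal_iff[OF \<open>S \<subseteq> {..<6}\<close>] all_less_6 by (simp add: C_simps)
  qed
  \<comment> \<open>Pairs within su(2) cancel because the action of X and Y on it is skew. The pairs
    of T with A, B, C give the su(2)-components of [T, X] and [T, Y], and the pair (T, T) gives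
    \<rho>.\<close>
  have geod: "totally_geodesic_foliation \<A> g nabla \<V> \<longleftrightarrow> \<rho> = 0 \<and>
      c12 * x1 + c22 * y1 = 0 \<and> c11 * x1 + c21 * y1 = 0 \<and> b11 * x1 + b21 * y1 = 0 \<and>
      c12 * x2 - c22 * x1 = 0 \<and> c11 * x2 - c21 * x1 = 0 \<and> b11 * x2 - b21 * x1 = 0"
    unfolding V totally_geodesic_iff all_less_6 by (simp add: C_simps) argo
  \<comment> \<open>With \<rho> = 0 the bracket [T, Y] has no T-component, so [T, X] and [T, Y] are
    combinations of X, Y and of A, B, C, which commute with T.\<close>
  have elliptic: "x1 = 0 \<and> y1 = 0 \<and> x2 = 0" if \<rho>: "\<rho> = 0" and nonneg: "0 \<le> x1\<^sup>2 + x2 * y1"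
  proof -
    have T: "T \<in> subgroup_lie_algebra \<A> mul e \<iota> ({mat 1} \<times> SO2)"
      unfolding assms(8) field_span_def by (rule CollectI, rule exI[of _ "[1]"]) (simp add: lincomb_def)
    have "g e (at_point T e) (at_point T e) = 1"
      using frame_orthonormal[of 3 3 e] by (simp add: L_def)
    then obtain \<gamma> P where sub: "one_parameter_subgroup \<A> mul e iv g (nth L) 6 \<gamma> T" and P: "0 < P" "\<gamma> P = e"
      using circle_subgroup[OF assms(4) T] by auto
    have inv: "left_invariant_field \<A> mul (L ! i)" if "i < 6" for i by (rule frame_left_invariant[OF that])
    have TQ: "lie_bracket T (L ! i) = vf_zero" if "i \<in> {0, 1, 2}" for i
      using that assms(15-17) by (auto simp: L_def)
    have TX: "lie_bracket T X f e = 0" if "smooth_fun \<A> f" for f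
      by (rule one_parameter_subgroup.periodic_bracket_vanishes[OF sub P, of x1 x2 y1 X Y "{0, 1, 2}" "nth L"
            "nth (U ! 3 ! 4)" "nth (U ! 3 ! 5)"])
         (use nonneg inv[of 0] inv[of 1] inv[of 2] inv[of 4] inv[of 5] that TQ \<rho> in \<open>auto simp: br U_def bracket_table_def L_def\<close>)
    \<comment> \<open>Exchanging X and Y turns (x1, x2, y1) into (- x1, y1, x2) and preserves x1^2 +
      x2 y1.\<close>
    have TY: "lie_bracket T Y f e = 0" if "smooth_fun \<A> f" for f
      by (rule one_parameter_subgroup.periodic_bracket_vanishes[OF sub P, of "- x1" y1 x2 Y X "{0, 1, 2}" "nth L"
            "nth (U ! 3 ! 5)" "nth (U ! 3 ! 4)"])
         (use nonneg inv[of 0] inv[of 1] inv[of 2] inv[of 4] inv[of 5] that TQ \<rho> in \<open>auto simp: br U_def bracket_table_def L_def mult.commute\<close>)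
    have zero: "antisym_table U 3 k l = 0" if k: "k = 4 \<or> k = 5" and l: "l < 6" for k l
    proof -
      have "comb (antisym_table U 3 k) e f = comb (\<lambda>l. 0) e f" for f
      proof (cases "smooth_fun \<A> f")
        case True
        then have "lie_bracket (L ! 3) (L ! k) f e = 0" using TX TY k by (auto simp: L_def)
        moreover have "3 < (6::nat)" "k < 6" using k by auto
        ultimately show ?thesis using structure_constants[of 3 k f e] by (simp add: comb_def)
      next
        case False
        then show ?thesis using tangent_space_nonsmooth[OF comb_tangent] by simp
      qed
      then show ?thesis using comb_eq_iff[of "antisym_table U 3 k" e "\<lambda>l. 0"] l by blast
    qed
    show ?thesis
      using zero[of 4 4] zero[of 4 5] zero[of 5 4] by (simp add: C_simps)
  qed
  \<comment> \<open>The pair (p, q) stands for (c12, c22), (c11, c21) or (b11, b21). Either M = 0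
    and both sides hold, or M is invertible with y1 \<noteq> 0 and both sides say p = q = 0.\<close>
  have solve: "p * x1 + q * y1 = 0 \<and> p * x2 - q * x1 = 0 \<longleftrightarrow> y1 * p = 0 \<and> y1 * q = 0" if "\<rho> = 0" for p q
  proof (cases "0 \<le> x1\<^sup>2 + x2 * y1")
    case True
    then show ?thesis using elliptic[OF that] by simp
  next
    case False
    then have "y1 \<noteq> 0" by auto
    have "p = 0" if "p * x1 + q * y1 = 0" "p * x2 - q * x1 = 0"
    proof -
      \<comment> \<open>This combination of the two equations eliminates q and leaves p times - det
        M.\<close>
      have "p * (x1\<^sup>2 + x2 * y1) = x1 * (p * x1 + q * y1) + y1 * (p * x2 - q * x1)"
        by (simp add: power2_eq_square algebra_simps)
      then show ?thesis using that False by auto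
    qed
    then show ?thesis using \<open>y1 \<noteq> 0\<close> by auto
  qed
  show ?thesis
    using riem conf riemannian_imp_conformal[of S] mini geod solve[of c12 c22] solve[of c11 c21] solve[of b11 b21]
    unfolding V by blast
qed

end
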